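(* Let $0<\alpha<\beta<1$, let $x(0)\in\mathbb{R}^n$ be arbitrary initial values, let $B\ge 1$ be an integer, and let $G(t)$, $t=1,2,\ldots$, be any $B$-core-connected sequence of undirected graphs on $\{1,\ldots,n\}$ with a self-loop at every node. Let $x(t)$ be generated by the ternary-message protocol described in the context. Then for every node $i$, \[ \lim_{t\to\infty} x_i(t)=\frac1n\sum_{j=1}^n x_j(0). \] Moreover, for every $\epsilon>0$, if the integer $t$ satisfies \[ t\ \ge\ 2^{\frac{1}{1-\beta}}\left(2^{\frac{2}{1-\alpha}}\lceil 32B+8BW(0)\rceil^{\frac{1}{\beta-\alpha}}+\left(32B\|x(0)\|_\infty\right)^{\frac{2}{1-\alpha}}+11B+(300n^3DB)^{\frac{1}{1-\beta}}\right)+\max\left(\left(150n^3DB\log\frac{V_2(0)}{\epsilon}\right)^{\frac{1}{1-\beta}},\left(\frac{8n^{1.5}}{\epsilon}\right)^{\frac1\alpha}\right), \] then $V_2(x(t))\le\epsilon$. (If $V_2(0)\le\epsilon$, the term containing the logarithm is read as $0$.)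
   Context: Protocol. There are $n$ nodes $\{1,\ldots,n\}$, parameters $0<\alpha<\beta<1$, and a sequence $G(t)=(\{1,\ldots,n\},E(t))$, $t=1,2,\ldots$, of undirected graphs with a self-loop at every node. $N_i(t)$ is the set of neighbors and $d_i(t)$ the degree of $i$ in $G(t)$. For each $t$ and each $(i,j)\in E(t)$ a real number $D(i,j,t)$ is given with $D(i,j,t)=D(j,i,t)$ and $D(i,j,t)\ge\max(d_i(t),d_j(t))$; these numbers are uniformly bounded above. Node $i$ has initial value $x_i(0)\in\mathbb{R}$. For each $j$ that has been its neighbor, node $i$ keeps variables $\widehat x_{i,j,\mathrm{in}}$, $\widehat x_{i,j,\mathrm{out}}$; if $s$ is the first time with $(i,j)\in E(s)$, then $\widehat x_{i,j,\mathrm{in}}(s-1)=\widehat x_{i,j,\mathrm{out}}(s-1)=0$. At each $t=1,2,\ldots$, node $i$ sends to each neighbor $j\in N_i(t)$ the message $q_{i\to j}(t)=R[t^{\alpha}(x_i(t-1)-\widehat x_{i,j,\mathrm{out}}(t-1))]$, where $R[x]=1$ if $x>1$, $R[x]=0$ if $-1\le x\le1$, $R[x]=-1$ if $x<-1$. Then, for $(i,j)\in E(t)$, $\widehat x_{i,j,\mathrm{out}}(t)=\widehat x_{i,j,\mathrm{out}}(t-1)+q_{i\to j}(t)/t^{\alpha}$ and $\widehat x_{i,j,\mathrm{in}}(t)=\widehat x_{i,j,\mathrm{in}}(t-1)+q_{j\to i}(t)/t^{\alpha}$; if $(i,j)\notin E(t)$, already-initialized variables are left unchanged. Finally \[ x_i(t)=x_i(t-1)+\frac1{t^{\beta}}\sum_{j\in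 S(i,t)}\frac{\widehat x_{i,j,\mathrm{in}}(t)-\widehat x_{i,j,\mathrm{out}}(t)}{4D(i,j,t)}, \] where $S(i,t)$ is the set of $j\in N_i(t)$ with $|\widehat x_{i,j,\mathrm{in}}(t)-\widehat x_{i,j,\mathrm{out}}(t)|>4/t^{\alpha}$ and $q_{i\to j}(t)=q_{j\to i}(t)=0$. $B$-core-connectivity. The sequence $G(t)$ is $B$-core-connected if there is a set of edges $E_\infty\subset\bigcup_t E(t)$ such that $(\{1,\ldots,n\},E_\infty)$ is connected and $E_\infty\subset\bigcup_{t=kB+1}^{(k+1)B}E(t)$ for every integer $k\ge0$. Notation. $D=\sup_{i,j,t}D(i,j,t)$; $W(x)=\max_i x_i-\min_i x_i$; $V_2(x)=\sqrt{\sum_{i=1}^n(x_i-\frac1n\sum_{j=1}^n x_j)^2}$; $W(t)=W(x(t))$, $V_2(t)=V_2(x(t))$; $\lceil x\rceil$ is the smallest integer at least $x$; $\log$ is the natural logarithm. *)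

theory Defs
  imports Complex_Main
begin

text \<open>Nodes are the numbers in \<open>{1..n}\<close> and times are natural numbers. An undirected graph with
  self-loops is a symmetric relation on \<open>{1..n}\<close>, reflexive there. Only the graphs \<open>E t\<close> with
  \<open>t \<ge> 1\<close> matter. A vector in \<open>\<real>\<^sup>n\<close> is a function \<open>nat \<Rightarrow> real\<close> of which only the values on \<open>{1..n}\<close>
  are used.\<close>

definition graph_sequence :: "nat \<Rightarrow> (nat \<Rightarrow> (nat \<times> nat) set) \<Rightarrow> bool" where
  "graph_sequence n E \<longleftrightarrow>
     (\<forall>t\<ge>1. E t \<subseteq> {1..n} \<times> {1..n} \<and> sym (E t) \<and> (\<forall>i\<in>{1..n}. (i, i) \<in> E t))"

definition connected_on :: "nat \<Rightarrow> (nat \<times> nat) set \<Rightarrow> bool" where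
  "connected_on n F \<longleftrightarrow> (\<forall>i\<in>{1..n}. \<forall>j\<in>{1..n}. (i, j) \<in> F\<^sup>*)"

definition core_connected :: "nat \<Rightarrow> nat \<Rightarrow> (nat \<Rightarrow> (nat \<times> nat) set) \<Rightarrow> bool" where
  "core_connected n B E \<longleftrightarrow>
     (\<exists>Einf. Einf \<subseteq> (\<Union>t\<in>{1..}. E t) \<and> sym Einf \<and> connected_on n Einf \<and>
        (\<forall>k. Einf \<subseteq> (\<Union>t\<in>{k * B + 1..(k + 1) * B}. E t)))"

definition nbrs :: "(nat \<Rightarrow> (nat \<times> nat) set) \<Rightarrow> nat \<Rightarrow> nat \<Rightarrow> nat set" where
  "nbrs E i t = {j. (i, j) \<in> E t}"

text \<open>The self-loop makes a node one of its own neighbors, so it contributes one to the degree.\<close>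

definition deg :: "(nat \<Rightarrow> (nat \<times> nat) set) \<Rightarrow> nat \<Rightarrow> nat \<Rightarrow> nat" where
  "deg E i t = card (nbrs E i t)"

text \<open>The numbers \<open>D i j t\<close> are meaningful only for \<open>t \<ge> 1\<close> and \<open>(i, j) \<in> E t\<close>; the supremum
  below, too, ranges over these triples only.\<close>

definition weight_values ::
    "(nat \<Rightarrow> (nat \<times> nat) set) \<Rightarrow> (nat \<Rightarrow> nat \<Rightarrow> nat \<Rightarrow> real) \<Rightarrow> real set" where
  "weight_values E D = {D i j t | i j t. t \<ge> 1 \<and> (i, j) \<in> E t}"

definition admissible_weights ::
    "(nat \<Rightarrow> (nat \<times> nat) set) \<Rightarrow> (nat \<Rightarrow> nat \<Rightarrow> nat \<Rightarrow> real) \<Rightarrow> bool" where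
  "admissible_weights E D \<longleftrightarrow>
     (\<forall>t\<ge>1. \<forall>i j. (i, j) \<in> E t \<longrightarrow>
        D i j t = D j i t \<and> D i j t \<ge> max (real (deg E i t)) (real (deg E j t))) \<and>
     bdd_above (weight_values E D)"

definition Dsup ::
    "(nat \<Rightarrow> (nat \<times> nat) set) \<Rightarrow> (nat \<Rightarrow> nat \<Rightarrow> nat \<Rightarrow> real) \<Rightarrow> real" where
  "Dsup E D = Sup (weight_values E D)"

definition ternary :: "real \<Rightarrow> real" where
  "ternary y = (if y > 1 then 1 else if y < -1 then -1 else 0)"

text \<open>A trajectory \<open>x\<close> is indexed as \<open>x t i\<close>, and \<open>xin t i j\<close>, \<open>xout t i j\<close> are the variables that
  node \<open>i\<close> keeps for node \<open>j\<close> at time \<open>t\<close>.\<close>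

definition msg ::
    "real \<Rightarrow> (nat \<Rightarrow> nat \<Rightarrow> real) \<Rightarrow> (nat \<Rightarrow> nat \<Rightarrow> nat \<Rightarrow> real) \<Rightarrow> nat \<Rightarrow> nat \<Rightarrow> nat \<Rightarrow> real" where
  "msg \<alpha> x xout t i j = ternary (real t powr \<alpha> * (x (t - 1) i - xout (t - 1) i j))"

definition active ::
    "real \<Rightarrow> (nat \<Rightarrow> (nat \<times> nat) set) \<Rightarrow> (nat \<Rightarrow> nat \<Rightarrow> real) \<Rightarrow>
     (nat \<Rightarrow> nat \<Rightarrow> nat \<Rightarrow> real) \<Rightarrow> (nat \<Rightarrow> nat \<Rightarrow> nat \<Rightarrow> real) \<Rightarrow> nat \<Rightarrow> nat \<Rightarrow> nat set" where
  "active \<alpha> E x xin xout i t =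
     {j \<in> nbrs E i t. \<bar>xin t i j - xout t i j\<bar> > 4 / real t powr \<alpha> \<and>
        msg \<alpha> x xout t i j = 0 \<and> msg \<alpha> x xout t j i = 0}"

text \<open>The four conditions: initialization just before the first time \<open>i\<close> and \<open>j\<close> are neighbors
  (before that, \<open>xin\<close> and \<open>xout\<close> are unconstrained and never read); update along current edges;
  no change of initialized variables otherwise; update of the node values.\<close>

definition protocol_run ::
    "nat \<Rightarrow> real \<Rightarrow> real \<Rightarrow> (nat \<Rightarrow> (nat \<times> nat) set) \<Rightarrow> (nat \<Rightarrow> nat \<Rightarrow> nat \<Rightarrow> real) \<Rightarrow>
     (nat \<Rightarrow> nat \<Rightarrow> real) \<Rightarrow> (nat \<Rightarrow> nat \<Rightarrow> nat \<Rightarrow> real) \<Rightarrow> (nat \<Rightarrow> nat \<Rightarrow> nat \<Rightarrow> real) \<Rightarrow> bool" where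
  "protocol_run n \<alpha> \<beta> E D x xin xout \<longleftrightarrow>
     (\<forall>s\<ge>1. \<forall>i j. (i, j) \<in> E s \<and> (\<forall>r. 1 \<le> r \<and> r < s \<longrightarrow> (i, j) \<notin> E r) \<longrightarrow>
        xin (s - 1) i j = 0 \<and> xout (s - 1) i j = 0) \<and>
     (\<forall>t\<ge>1. \<forall>i j. (i, j) \<in> E t \<longrightarrow>
        xout t i j = xout (t - 1) i j + msg \<alpha> x xout t i j / real t powr \<alpha> \<and>
        xin t i j = xin (t - 1) i j + msg \<alpha> x xout t j i / real t powr \<alpha>) \<and>
     (\<forall>t\<ge>1. \<forall>i j. (i, j) \<notin> E t \<and> (\<exists>r. 1 \<le> r \<and> r < t \<and> (i, j) \<in> E r) \<longrightarrow>
        xout t i j = xout (t - 1) i j \<and> xin t i j = xin (t - 1) i j) \<and>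
     (\<forall>t\<ge>1. \<forall>i\<in>{1..n}.
        x t i = x (t - 1) i + 1 / real t powr \<beta> *
          (\<Sum>j\<in>active \<alpha> E x xin xout i t. (xin t i j - xout t i j) / (4 * D i j t)))"

definition spread :: "nat \<Rightarrow> (nat \<Rightarrow> real) \<Rightarrow> real" where
  "spread n v = Max (v ` {1..n}) - Min (v ` {1..n})"

definition V2 :: "nat \<Rightarrow> (nat \<Rightarrow> real) \<Rightarrow> real" where
  "V2 n v = sqrt (\<Sum>i=1..n. (v i - (1 / real n) * (\<Sum>j=1..n. v j))\<^sup>2)"

definition sup_norm :: "nat \<Rightarrow> (nat \<Rightarrow> real) \<Rightarrow> real" where
  "sup_norm n v = Max ((\<lambda>i. \<bar>v i\<bar>) ` {1..n})"

end

theory Submission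
  imports Defs "HOL-Library.Transitive_Closure_Table" "HOL-Analysis.Convex"
begin

text \<open>
  If both messages on an edge vanish, then each of the two estimates is within \<open>t powr - \<alpha>\<close> of the
  true value. On an active edge the difference of the estimates is therefore comparable to the
  difference of the values, and the update is an averaging step with symmetric weights of size
  about \<open>1 / (D * t powr \<beta>)\<close>. Such a step preserves the sum and the range, and it lowers the squared
  deviation from the mean by the energy dissipated on the active edges.

  Since \<open>\<alpha> < \<beta>\<close>, the values eventually drift, over \<open>B\<close> steps, by much less than one message
  \<open>t powr - \<alpha>\<close>, while the messages add up to infinity. So from some time on every core edge is
  tracked within \<open>9/8\<close> of a message. A tracked edge direction sends at most one nonzero message in
  three consecutive blocks, hence every core edge has a time in each window of \<open>3 * B\<close> steps at which
  it is silent in both directions. At that time it is either active or has nearly equal end points.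
  Summing along a simple path from the minimum to the maximum bounds the squared deviation by the
  energy dissipated in the window, unless the deviation is already of the order of
  \<open>n powr 1.5 * t powr - \<alpha>\<close>.
\<close>

section \<open>Symmetric averaging\<close>

locale averaging_step =
  fixes I :: "'a set" and w :: "'a \<Rightarrow> 'a \<Rightarrow> real" and r :: real and x y :: "'a \<Rightarrow> real"
  assumes fin: "finite I"
    and sym: "\<And>i j. i \<in> I \<Longrightarrow> j \<in> I \<Longrightarrow> w i j = w j i"
    and nonneg: "\<And>i j. i \<in> I \<Longrightarrow> j \<in> I \<Longrightarrow> 0 \<le> w i j"
    and row: "\<And>i. i \<in> I \<Longrightarrow> (\<Sum>j\<in>I. w i j) \<le> r"
    and r_le: "r \<le> 1 / 2"
    and update: "\<And>i. i \<in> I \<Longrightarrow> y i = x i + (\<Sum>j\<in>I. w i j * (x j - x i))"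
begin

definition energy :: real where
  "energy = (\<Sum>i\<in>I. \<Sum>j\<in>I. w i j * (x i - x j)\<^sup>2)"

lemma energy_nonneg: "0 \<le> energy"
  unfolding energy_def by (intro sum_nonneg mult_nonneg_nonneg nonneg) auto

lemma sum_swap: "(\<Sum>i\<in>I. \<Sum>j\<in>I. w i j * g i j) = (\<Sum>i\<in>I. \<Sum>j\<in>I. w i j * g j i)"
proof -
  have "(\<Sum>i\<in>I. \<Sum>j\<in>I. w i j * g i j) = (\<Sum>j\<in>I. \<Sum>i\<in>I. w i j * g i j)"
    by (rule sum.swap)
  also have "\<dots> = (\<Sum>i\<in>I. \<Sum>j\<in>I. w i j * g j i)"
    by (intro sum.cong refl) (simp add: sym)
  finally show ?thesis .
qed

lemma sum_preserved: "sum y I = sum x I"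
proof -
  have "(\<Sum>i\<in>I. \<Sum>j\<in>I. w i j * (x j - x i)) = (\<Sum>i\<in>I. \<Sum>j\<in>I. w i j * (x i - x j))"
    by (rule sum_swap)
  also have "\<dots> = - (\<Sum>i\<in>I. \<Sum>j\<in>I. w i j * (x j - x i))"
    by (simp add: sum_negf[symmetric] algebra_simps)
  finally have "(\<Sum>i\<in>I. \<Sum>j\<in>I. w i j * (x j - x i)) = 0" by simp
  then show ?thesis by (simp add: update sum.distrib)
qed

text \<open>Cauchy-Schwarz on the step \<open>y i - x i\<close>, with each weight split into two
  square roots; one of the two resulting factors is a row sum.\<close>

lemma step_sq:
  assumes "i \<in> I"
  shows "(y i - x i)\<^sup>2 \<le> r * (\<Sum>j\<in>I. w i j * (x i - x j)\<^sup>2)"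
proof -
  have "(y i - x i)\<^sup>2 = (\<Sum>j\<in>I. sqrt (w i j) * (sqrt (w i j) * (x j - x i)))\<^sup>2"
    using assms by (simp add: update mult.assoc[symmetric] nonneg cong: sum.cong)
  also have "\<dots> \<le> (\<Sum>j\<in>I. (sqrt (w i j))\<^sup>2) * (\<Sum>j\<in>I. (sqrt (w i j) * (x j - x i))\<^sup>2)"
    by (rule Cauchy_Schwarz_ineq_sum)
  also have "\<dots> = (\<Sum>j\<in>I. w i j) * (\<Sum>j\<in>I. w i j * (x i - x j)\<^sup>2)"
    using assms by (simp add: nonneg power_mult_distrib power2_commute cong: sum.cong)
  also have "\<dots> \<le> r * (\<Sum>j\<in>I. w i j * (x i - x j)\<^sup>2)"
    using assms by (intro mult_right_mono row sum_nonneg mult_nonneg_nonneg nonneg) auto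
  finally show ?thesis .
qed

lemma sum_step_sq: "(\<Sum>i\<in>I. (y i - x i)\<^sup>2) \<le> r * energy"
  unfolding energy_def sum_distrib_left[of r] by (intro sum_mono step_sq[unfolded sum_distrib_left])

text \<open>Expand the square around \<open>x\<close>. By symmetry of the weights the cross term is
  exactly \<open>- energy\<close>; the second-order term gives back at most
  \<open>energy / 2\<close> because \<open>r\<close> is at most 1/2. Note that \<open>energy\<close>
  counts each unordered pair twice.\<close>

lemma sum_sq_dist: "(\<Sum>i\<in>I. (y i - c)\<^sup>2) \<le> (\<Sum>i\<in>I. (x i - c)\<^sup>2) - energy / 2"
proof -
  let ?S = "\<Sum>i\<in>I. \<Sum>j\<in>I. w i j * ((x i - c) * (x j - x i))"
  have "?S + ?S = ?S + (\<Sum>i\<in>I. \<Sum>j\<in>I. w i j * ((x j - c) * (x i - x j)))"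
    by (subst (2) sum_swap) simp
  also have "\<dots> = - energy"
    unfolding energy_def sum.distrib[symmetric] sum_negf[symmetric]
    by (intro sum.cong refl) (simp add: power2_eq_square algebra_simps)
  finally have S: "2 * ?S = - energy" by simp
  have "(\<Sum>i\<in>I. (y i - c)\<^sup>2) = (\<Sum>i\<in>I. (x i - c)\<^sup>2 + 2 * ((x i - c) * (y i - x i)) + (y i - x i)\<^sup>2)"
    by (intro sum.cong refl) (simp add: power2_eq_square algebra_simps)
  also have "\<dots> = (\<Sum>i\<in>I. (x i - c)\<^sup>2) + 2 * (\<Sum>i\<in>I. (x i - c) * (y i - x i)) + (\<Sum>i\<in>I. (y i - x i)\<^sup>2)"
    by (simp add: sum.distrib sum_distrib_left)
  also have "(\<Sum>i\<in>I. (x i - c) * (y i - x i)) = ?S"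
    by (intro sum.cong refl) (simp add: update sum_distrib_left algebra_simps)
  also have "(\<Sum>i\<in>I. (y i - x i)\<^sup>2) \<le> 1 / 2 * energy"
    using sum_step_sq mult_right_mono[OF r_le energy_nonneg] by linarith
  finally show ?thesis using S by simp
qed

text \<open>\<open>y i\<close> is a convex combination of the old values, as the weights are
  nonnegative and the row sum is at most 1. The bound on the displacement is what later limits the
  drift.\<close>

lemma range_step:
  assumes i: "i \<in> I" and x: "\<And>j. j \<in> I \<Longrightarrow> a \<le> x j \<and> x j \<le> b"
  shows "a \<le> y i" "y i \<le> b" "\<bar>y i - x i\<bar> \<le> r * (b - a)"
proof -
  have ab: "a \<le> x i" "x i \<le> b" using x[OF i] by auto
  let ?s = "\<Sum>j\<in>I. w i j"
  have s0: "0 \<le> ?s" using i by (intro sum_nonneg nonneg)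
  have s1: "?s \<le> 1" using row[OF i] r_le by simp
  have up: "y i - x i \<le> ?s * (b - x i)"
    using i x by (auto simp: update sum_distrib_right intro!: sum_mono mult_left_mono nonneg)
  have lo: "?s * (a - x i) \<le> y i - x i"
    using i x by (auto simp: update sum_distrib_right intro!: sum_mono mult_left_mono nonneg)
  have "?s * (b - x i) \<le> 1 * (b - x i)" using s1 ab by (intro mult_right_mono) auto
  then show "y i \<le> b" using up by simp
  have "?s * (x i - a) \<le> 1 * (x i - a)" using s1 ab by (intro mult_right_mono) auto
  then show "a \<le> y i" using lo by (simp add: algebra_simps)
  have "?s * (b - x i) \<le> r * (b - a)" "?s * (x i - a) \<le> r * (b - a)"
    using s0 ab row[OF i] by (auto intro!: mult_mono)
  then show "\<bar>y i - x i\<bar> \<le> r * (b - a)" using up lo by (simp add: algebra_simps abs_le_iff)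
qed

end

section \<open>Simple paths and windows of consecutive averaging steps\<close>

lemma rtrancl_simple_path:
  assumes "(a, b) \<in> F\<^sup>*"
  obtains p :: "nat \<Rightarrow> 'a" and m where "inj_on p {..m}" "p 0 = a" "p m = b"
    "\<And>k. k < m \<Longrightarrow> (p k, p (Suc k)) \<in> F"
proof -
  have "(\<lambda>u v. (u, v) \<in> F)\<^sup>*\<^sup>* a b"
    using assms by (simp add: rtranclp_rtrancl_eq)
  then obtain ys where "rtrancl_path (\<lambda>u v. (u, v) \<in> F) a ys b"
    unfolding rtranclp_eq_rtrancl_path by blast
  then obtain xs where xs: "rtrancl_path (\<lambda>u v. (u, v) \<in> F) a xs b" "distinct (a # xs)"
    by (rule rtrancl_path_distinct)
  have last: "(a # xs) ! length xs = b"
    using xs(1) rtrancl_path_last[OF xs(1)]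
    by (cases "xs = []") (auto simp: nth_Cons' last_conv_nth elim: rtrancl_path.cases)
  show thesis
  proof
    show "inj_on (\<lambda>k. (a # xs) ! k) {..length xs}"
      using xs(2) by (auto simp: inj_on_def nth_eq_iff_index_eq simp del: nth_Cons_Suc)
    show "(a # xs) ! length xs = b" by (rule last)
    show "((a # xs) ! k, (a # xs) ! Suc k) \<in> F" if "k < length xs" for k
      using rtrancl_path_nth[OF xs(1) that] by simp
  qed simp
qed

locale averaging_window =
  fixes I :: "'a set" and w :: "nat \<Rightarrow> 'a \<Rightarrow> 'a \<Rightarrow> real" and r :: real
    and z :: "nat \<Rightarrow> 'a \<Rightarrow> real" and L :: nat
  assumes finI: "finite I"
    and step: "\<And>\<tau>. \<tau> < L \<Longrightarrow> averaging_step I (w \<tau>) r (z \<tau>) (z (Suc \<tau>))"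
begin

definition total_energy :: real where
  "total_energy = (\<Sum>\<tau><L. averaging_step.energy I (w \<tau>) (z \<tau>))"

lemma total_energy_nonneg: "0 \<le> total_energy"
  unfolding total_energy_def by (intro sum_nonneg averaging_step.energy_nonneg[OF step]) auto

lemma sum_sq_dist_window:
  "(\<Sum>i\<in>I. (z L i - c)\<^sup>2) \<le> (\<Sum>i\<in>I. (z 0 i - c)\<^sup>2) - total_energy / 2"
proof -
  have "(\<Sum>i\<in>I. (z m i - c)\<^sup>2)
      \<le> (\<Sum>i\<in>I. (z 0 i - c)\<^sup>2) - (\<Sum>\<tau><m. averaging_step.energy I (w \<tau>) (z \<tau>)) / 2"
    if "m \<le> L" for m
    using that
  proof (induction m)
    case (Suc m)
    then show ?case using averaging_step.sum_sq_dist[OF step[of m], of c]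
      by (simp add: add_divide_distrib)
  qed simp
  then show ?thesis unfolding total_energy_def by simp
qed

definition travel :: "'a \<Rightarrow> real" where
  "travel i = (\<Sum>\<tau><L. \<bar>z (Suc \<tau>) i - z \<tau> i\<bar>)"

lemma travel_nonneg: "0 \<le> travel i"
  unfolding travel_def by (simp add: sum_nonneg)

lemma dist_le_travel:
  assumes "s \<le> L"
  shows "\<bar>z s i - z 0 i\<bar> \<le> travel i"
proof -
  have "z s i - z 0 i = (\<Sum>\<tau><s. z (Suc \<tau>) i - z \<tau> i)" using sum_lessThan_telescope[of "\<lambda>\<tau>. z \<tau> i" s] by simp
  also have "\<bar>\<dots>\<bar> \<le> (\<Sum>\<tau><s. \<bar>z (Suc \<tau>) i - z \<tau> i\<bar>)" by (rule sum_abs)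
  also have "\<dots> \<le> travel i" unfolding travel_def using assms by (intro sum_mono2) auto
  finally show ?thesis .
qed

text \<open>Cauchy-Schwarz twice, over the \<open>L\<close> times and over the nodes, reduces the
  total movement to the squared steps, which \<open>sum_step_sq\<close> bounds by energy.\<close>

lemma sum_travel_sq: "(\<Sum>i\<in>I. travel i)\<^sup>2 \<le> real (card I) * real L * r * total_energy"
proof -
  have "(\<Sum>i\<in>I. (travel i)\<^sup>2) \<le> (\<Sum>i\<in>I. (\<Sum>\<tau><L. \<bar>z (Suc \<tau>) i - z \<tau> i\<bar>\<^sup>2) * card {..<L})"
    unfolding travel_def by (intro sum_mono sum_squared_le_sum_of_squares)
  also have "\<dots> = (\<Sum>\<tau><L. \<Sum>i\<in>I. (z (Suc \<tau>) i - z \<tau> i)\<^sup>2) * real L"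
    by (subst sum.swap) (simp add: sum_distrib_right)
  also have "\<dots> \<le> (\<Sum>\<tau><L. r * averaging_step.energy I (w \<tau>) (z \<tau>)) * real L"
    by (intro mult_right_mono sum_mono averaging_step.sum_step_sq[OF step]) auto
  also have "\<dots> = real L * r * total_energy"
    unfolding total_energy_def sum_distrib_left[symmetric] by simp
  finally have "(\<Sum>i\<in>I. (travel i)\<^sup>2) * card I \<le> real L * r * total_energy * card I"
    by (intro mult_right_mono) auto
  with sum_squared_le_sum_of_squares[of travel I] show ?thesis
    by (simp add: mult_ac)
qed

text \<open>The path is simple, so the travel of each node is charged at most twice and the number of
  summands is bounded by the number of nodes instead of the number of edges.\<close>

lemma spread_window:
  assumes F: "F \<subseteq> I \<times> I" and ab: "(a, b) \<in> F\<^sup>*" and aI: "a \<in> I"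
    and \<omega>: "0 < \<omega>" and \<eta>: "0 \<le> \<eta>"
    and good: "\<And>i j. (i, j) \<in> F \<Longrightarrow> i \<noteq> j \<Longrightarrow>
      \<exists>s<L. \<omega> \<le> w s i j \<or> \<bar>z s i - z s j\<bar> \<le> \<eta>"
    and big: "real (card I) * \<eta> \<le> z 0 a - z 0 b"
  shows "(z 0 a - z 0 b - real (card I) * \<eta>)\<^sup>2
    \<le> real (card I) * total_energy * (5 / (4 * \<omega>) + 20 * (real L * r))"
proof -
  let ?n = "real (card I)"
  obtain p m where inj: "inj_on p {..m}" and p0: "p 0 = a" and pm: "p m = b"
    and pF: "\<And>k. k < m \<Longrightarrow> (p k, p (Suc k)) \<in> F"
    using rtrancl_simple_path[OF ab] by metis
  have pI: "p k \<in> I" if "k \<le> m" for k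
    using that pF[of "k - 1"] F p0 aI by (cases k) auto
  then have sub: "p ` {..<m} \<subseteq> I" "(\<lambda>k. p (Suc k)) ` {..<m} \<subseteq> I"
    by (auto simp: Suc_le_eq)
  have "card (p ` {..m}) \<le> card I" using pI finI by (intro card_mono) auto
  then have m_le: "Suc m \<le> card I" using inj by (simp add: card_image)
  have inj': "inj_on (\<lambda>k. p (Suc k)) {..<m}" and inj'': "inj_on p {..<m}"
    using inj by (auto intro!: inj_onI dest: inj_onD[OF inj])
  have "\<exists>s. s < L \<and> (\<omega> \<le> w s (p k) (p (Suc k)) \<or> \<bar>z s (p k) - z s (p (Suc k))\<bar> \<le> \<eta>)"
    if "k < m" for k
  proof -
    have "p k \<noteq> p (Suc k)" using inj_onD[OF inj, of k "Suc k"] that by auto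
    then show ?thesis using good[OF pF[OF that]] by blast
  qed
  then obtain s where sL: "\<And>k. k < m \<Longrightarrow> s k < L"
    and s: "\<And>k. k < m \<Longrightarrow> \<omega> \<le> w (s k) (p k) (p (Suc k)) \<or> \<bar>z (s k) (p k) - z (s k) (p (Suc k))\<bar> \<le> \<eta>"
    by metis
  \<comment> \<open>Position \<open>k\<close> of the path is inspected at its own time
    \<open>s k\<close>. \<open>Act\<close> collects the positions whose edge carries enough weight
    at that time; at all others the difference is at most \<open>\<eta>\<close>.\<close>
  define g where "g k = \<bar>z (s k) (p k) - z (s k) (p (Suc k))\<bar>" for k
  define Act where "Act = {k. k < m \<and> \<omega> \<le> w (s k) (p k) (p (Suc k))}"
  have fAct: "finite Act" "Act \<subseteq> {..<m}" unfolding Act_def by auto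
  have "z 0 a - z 0 b = - (\<Sum>k<m. z 0 (p (Suc k)) - z 0 (p k))"
    using sum_lessThan_telescope[of "\<lambda>k. z 0 (p k)" m] by (simp add: p0 pm)
  also have "\<dots> = (\<Sum>k<m. z 0 (p k) - z 0 (p (Suc k)))"
    by (simp add: sum_negf[symmetric])
  also have "\<dots> \<le> (\<Sum>k<m. \<eta> + (if k \<in> Act then g k else 0) + travel (p k) + travel (p (Suc k)))"
  proof (intro sum_mono)
    fix k assume "k \<in> {..<m}"
    then have k: "k < m" by simp
    \<comment> \<open>Passing from time 0 to time \<open>s k\<close> costs at most the travel of
      both end points.\<close>
    have "z 0 (p k) - z 0 (p (Suc k)) \<le> g k + travel (p k) + travel (p (Suc k))"
      using dist_le_travel[of "s k" "p k"] dist_le_travel[of "s k" "p (Suc k)"] sL[OF k]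
      unfolding g_def by linarith
    moreover have "g k \<le> \<eta> + (if k \<in> Act then g k else 0)"
      using s[OF k] k \<eta> by (auto simp: g_def Act_def)
    ultimately show "z 0 (p k) - z 0 (p (Suc k))
        \<le> \<eta> + (if k \<in> Act then g k else 0) + travel (p k) + travel (p (Suc k))"
      by linarith
  qed
  also have "\<dots> = m * \<eta> + sum g Act + (\<Sum>k<m. travel (p k)) + (\<Sum>k<m. travel (p (Suc k)))"
    using fAct by (simp add: sum.distrib sum.If_cases Int_absorb1 Int_absorb2)
  also have "\<dots> \<le> ?n * \<eta> + sum g Act + sum travel I + sum travel I"
  proof (intro add_mono order_refl)
    show "m * \<eta> \<le> ?n * \<eta>" using m_le \<eta> by (intro mult_right_mono) auto
    show "(\<Sum>k<m. travel (p k)) \<le> sum travel I"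
      using sum.reindex[OF inj'', of travel] sum_mono2[OF finI, of "p ` {..<m}" travel] sub
      by (auto simp: travel_nonneg)
    show "(\<Sum>k<m. travel (p (Suc k))) \<le> sum travel I"
      using sum.reindex[OF inj', of travel] sum_mono2[OF finI, of "(\<lambda>k. p (Suc k)) ` {..<m}" travel] sub
      by (auto simp: travel_nonneg)
  qed
  finally have le: "z 0 a - z 0 b - ?n * \<eta> \<le> sum g Act + 2 * sum travel I" by simp
  \<comment> \<open>The times \<open>s k\<close> vary with \<open>k\<close>, so the sum is first
    enlarged to all times of the window. At each fixed time the pairs along the path are distinct
    entries of the double sum in \<open>energy\<close>, because the path is simple.\<close>
  have "\<omega> * (\<Sum>k\<in>Act. (g k)\<^sup>2) \<le> (\<Sum>k<m. \<Sum>\<tau><L. w \<tau> (p k) (p (Suc k)) * (z \<tau> (p k) - z \<tau> (p (Suc k)))\<^sup>2)"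
  proof -
    have nn: "0 \<le> w \<tau> (p k) (p (Suc k)) * (z \<tau> (p k) - z \<tau> (p (Suc k)))\<^sup>2" if "\<tau> < L" "k < m" for \<tau> k
      using averaging_step.nonneg[OF step[OF that(1)]] pI that by simp
    have "\<omega> * (g k)\<^sup>2 \<le> (\<Sum>\<tau><L. w \<tau> (p k) (p (Suc k)) * (z \<tau> (p k) - z \<tau> (p (Suc k)))\<^sup>2)"
      if k: "k \<in> Act" for k
    proof -
      have "\<omega> * (g k)\<^sup>2 \<le> w (s k) (p k) (p (Suc k)) * (z (s k) (p k) - z (s k) (p (Suc k)))\<^sup>2"
        using k by (simp add: Act_def g_def mult_right_mono)
      also have "\<dots> \<le> (\<Sum>\<tau><L. w \<tau> (p k) (p (Suc k)) * (z \<tau> (p k) - z \<tau> (p (Suc k)))\<^sup>2)"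
        using k sL nn by (intro member_le_sum) (auto simp: Act_def)
      finally show ?thesis .
    qed
    then have "(\<Sum>k\<in>Act. \<omega> * (g k)\<^sup>2)
        \<le> (\<Sum>k\<in>Act. \<Sum>\<tau><L. w \<tau> (p k) (p (Suc k)) * (z \<tau> (p k) - z \<tau> (p (Suc k)))\<^sup>2)"
      by (rule sum_mono)
    also have "\<dots> \<le> (\<Sum>k<m. \<Sum>\<tau><L. w \<tau> (p k) (p (Suc k)) * (z \<tau> (p k) - z \<tau> (p (Suc k)))\<^sup>2)"
      using fAct nn by (intro sum_mono2) (auto intro!: sum_nonneg)
    finally show ?thesis by (simp add: sum_distrib_left)
  qed
  also have "\<dots> = (\<Sum>\<tau><L. \<Sum>k<m. w \<tau> (p k) (p (Suc k)) * (z \<tau> (p k) - z \<tau> (p (Suc k)))\<^sup>2)"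
    by (rule sum.swap)
  also have "\<dots> \<le> total_energy"
    unfolding total_energy_def
  proof (intro sum_mono)
    fix \<tau> assume "\<tau> \<in> {..<L}"
    then interpret S: averaging_step I "w \<tau>" r "z \<tau>" "z (Suc \<tau>)" by (intro step) simp
    have "(\<Sum>k<m. w \<tau> (p k) (p (Suc k)) * (z \<tau> (p k) - z \<tau> (p (Suc k)))\<^sup>2)
        \<le> (\<Sum>k<m. \<Sum>j\<in>I. w \<tau> (p k) j * (z \<tau> (p k) - z \<tau> j)\<^sup>2)"
      using pI S.nonneg finI
      by (intro sum_mono member_le_sum[where f = "\<lambda>j. w \<tau> (p _) j * (z \<tau> (p _) - z \<tau> j)\<^sup>2"]) auto
    also have "\<dots> = (\<Sum>i\<in>p ` {..<m}. \<Sum>j\<in>I. w \<tau> i j * (z \<tau> i - z \<tau> j)\<^sup>2)"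
      using sum.reindex[OF inj'', of "\<lambda>i. \<Sum>j\<in>I. w \<tau> i j * (z \<tau> i - z \<tau> j)\<^sup>2"] by simp
    also have "\<dots> \<le> S.energy"
      unfolding S.energy_def using finI pI S.nonneg by (intro sum_mono2) (auto intro!: sum_nonneg)
    finally show "(\<Sum>k<m. w \<tau> (p k) (p (Suc k)) * (z \<tau> (p k) - z \<tau> (p (Suc k)))\<^sup>2) \<le> S.energy" .
  qed
  finally have E: "(\<Sum>k\<in>Act. (g k)\<^sup>2) \<le> total_energy / \<omega>"
    using \<omega> by (simp add: field_simps)
  have "card Act \<le> card I" using fAct m_le card_mono[of "{..<m}" Act] by simp
  then have "(\<Sum>k\<in>Act. (g k)\<^sup>2) * card Act \<le> total_energy / \<omega> * ?n"
    using E \<omega> total_energy_nonneg by (intro mult_mono) auto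
  then have gA: "(sum g Act)\<^sup>2 \<le> total_energy / \<omega> * ?n"
    using sum_squared_le_sum_of_squares[of g Act] by linarith
  \<comment> \<open>The unequal split keeps the factor of the path term close to 1; the large factor
    20 falls on the travel term, which is small when \<open>real L * r\<close> is small.\<close>
  have young: "(u + 2 * v)\<^sup>2 \<le> 5 / 4 * u\<^sup>2 + 20 * v\<^sup>2" for u v :: real
    using zero_le_power2[of "u / 2 - 4 * v"] by (simp add: power2_eq_square algebra_simps)
  have "(z 0 a - z 0 b - ?n * \<eta>)\<^sup>2 \<le> (sum g Act + 2 * sum travel I)\<^sup>2"
    using le big by (intro power_mono) auto
  also have "\<dots> \<le> 5 / 4 * (sum g Act)\<^sup>2 + 20 * (sum travel I)\<^sup>2" by (rule young)
  also have "\<dots> \<le> 5 / 4 * (total_energy / \<omega> * ?n) + 20 * (?n * real L * r * total_energy)"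
    using gA sum_travel_sq by linarith
  also have "\<dots> = ?n * total_energy * (5 / (4 * \<omega>) + 20 * (real L * r))"
    using \<omega> by (simp add: field_simps)
  finally show ?thesis .
qed

end

section \<open>The protocol as symmetric averaging\<close>

locale protocol =
  fixes n B :: nat and \<alpha> \<beta> :: real
    and E :: "nat \<Rightarrow> (nat \<times> nat) set"
    and D :: "nat \<Rightarrow> nat \<Rightarrow> nat \<Rightarrow> real"
    and x :: "nat \<Rightarrow> nat \<Rightarrow> real"
    and xin xout :: "nat \<Rightarrow> nat \<Rightarrow> nat \<Rightarrow> real"
    and F :: "(nat \<times> nat) set"
  assumes n_pos: "n \<ge> 1" and B_pos: "B \<ge> 1"
    and \<alpha>_pos: "0 < \<alpha>" and \<alpha>_less: "\<alpha> < \<beta>" and \<beta>_less: "\<beta> < 1"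
    and graph: "graph_sequence n E"
    and F_conn: "connected_on n F"
    and F_block: "\<And>k. F \<subseteq> (\<Union>t\<in>{k * B + 1..(k + 1) * B}. E t)"
    and weights: "admissible_weights E D"
    and run: "protocol_run n \<alpha> \<beta> E D x xin xout"
begin

abbreviation act :: "nat \<Rightarrow> nat \<Rightarrow> nat set" where
  "act i t \<equiv> active \<alpha> E x xin xout i t"

abbreviation q :: "nat \<Rightarrow> nat \<Rightarrow> nat \<Rightarrow> real" where
  "q t i j \<equiv> msg \<alpha> x xout t i j"

text \<open>The quantum: the amount by which a nonzero message at time \<open>t\<close> changes an
  estimate, and also the threshold for sending one.\<close>

abbreviation c :: "nat \<Rightarrow> real" where
  "c t \<equiv> real t powr - \<alpha>"

abbreviation M :: real where "M \<equiv> sup_norm n (x 0)"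
abbreviation \<D> :: real where "\<D> \<equiv> Dsup E D"

lemma E_node: "(i, j) \<in> E t \<Longrightarrow> t \<ge> 1 \<Longrightarrow> i \<in> {1..n} \<and> j \<in> {1..n}"
  using graph unfolding graph_sequence_def by blast

lemma E_sym: "(i, j) \<in> E t \<Longrightarrow> t \<ge> 1 \<Longrightarrow> (j, i) \<in> E t"
  using graph unfolding graph_sequence_def sym_def by blast

lemma init:
  assumes "s \<ge> 1" "(i, j) \<in> E s" "\<And>r. 1 \<le> r \<Longrightarrow> r < s \<Longrightarrow> (i, j) \<notin> E r"
  shows "xin (s - 1) i j = 0" "xout (s - 1) i j = 0"
  using run[unfolded protocol_run_def, THEN conjunct1, rule_format, of s i j] assms by auto

lemma edge_update:
  assumes "t \<ge> 1" "(i, j) \<in> E t"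
  shows "xout t i j = xout (t - 1) i j + q t i j * c t"
    and "xin t i j = xin (t - 1) i j + q t j i * c t"
  using run[unfolded protocol_run_def, THEN conjunct2, THEN conjunct1, rule_format, OF assms]
  by (simp_all add: powr_minus_divide)

lemma no_edge_update:
  assumes "t \<ge> 1" "(i, j) \<notin> E t" "1 \<le> r" "r < t" "(i, j) \<in> E r"
  shows "xout t i j = xout (t - 1) i j" "xin t i j = xin (t - 1) i j"
  using run[unfolded protocol_run_def, THEN conjunct2, THEN conjunct2, THEN conjunct1, rule_format,
      OF assms(1), of i j] assms by auto

lemma node_update:
  assumes "t \<ge> 1" "i \<in> {1..n}"
  shows "x t i = x (t - 1) i + 1 / real t powr \<beta> *
    (\<Sum>j\<in>act i t. (xin t i j - xout t i j) / (4 * D i j t))"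
  using run[unfolded protocol_run_def, THEN conjunct2, THEN conjunct2, THEN conjunct2, rule_format,
      OF assms] .

text \<open>The estimates are unconstrained until just before the first occurrence of the edge, so
  the induction starts one step before that occurrence; this is why \<open>r \<le> Suc t\<close>
  suffices. Both directions are carried along because \<open>xin_eq_xout\<close> compares the copies
  kept by \<open>i\<close> and by \<open>j\<close>.\<close>

lemma edge_induct:
  assumes r: "1 \<le> r" "r \<le> Suc t" "(i, j) \<in> E r"
    and first: "\<And>s. xin s i j = 0 \<Longrightarrow> xout s i j = 0 \<Longrightarrow> xin s j i = 0 \<Longrightarrow> xout s j i = 0 \<Longrightarrow> P s"
    and edge: "\<And>s. (i, j) \<in> E (Suc s) \<Longrightarrow> P s \<Longrightarrow> P (Suc s)"
    and idle: "\<And>s. xin (Suc s) i j = xin s i j \<Longrightarrow> xout (Suc s) i j = xout s i j \<Longrightarrow>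
      xin (Suc s) j i = xin s j i \<Longrightarrow> xout (Suc s) j i = xout s j i \<Longrightarrow> P s \<Longrightarrow> P (Suc s)"
  shows "P t"
proof -
  define r0 where "r0 = (LEAST r. 1 \<le> r \<and> (i, j) \<in> E r)"
  have r0: "1 \<le> r0" "(i, j) \<in> E r0"
    using LeastI[of "\<lambda>r. 1 \<le> r \<and> (i, j) \<in> E r" r] r unfolding r0_def by auto
  have before: "(i, j) \<notin> E s" "(j, i) \<notin> E s" if "1 \<le> s" "s < r0" for s
    using not_less_Least[of s "\<lambda>r. 1 \<le> r \<and> (i, j) \<in> E r"] that E_sym[of j i s] unfolding r0_def by auto
  have "r0 - 1 \<le> t"
    using Least_le[of "\<lambda>r. 1 \<le> r \<and> (i, j) \<in> E r" r] r unfolding r0_def by simp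
  then show "P t"
  proof (induction t rule: dec_induct)
    case base
    show ?case
      using r0(1) init[OF r0 before(1)] init[OF r0(1) E_sym[OF r0(2,1)] before(2)] by (intro first) auto
  next
    case (step m)
    show ?case
    proof (cases "(i, j) \<in> E (Suc m)")
      case True
      then show ?thesis by (rule edge) (rule step.IH)
    next
      case False
      have "r0 < Suc m" using step.hyps r0 False by (cases "r0 = Suc m") auto
      then show ?thesis
        using False r0 E_sym[of j i "Suc m"] E_sym[OF r0(2,1)]
          no_edge_update[of "Suc m" i j r0] no_edge_update[of "Suc m" j i r0]
        by (intro idle step.IH) auto
    qed
  qed
qed

text \<open>The two copies start at zero at the same time and are changed by the same messages, so
  they never differ.\<close>

lemma xin_eq_xout:
  assumes "1 \<le> r" "r \<le> Suc t" "(i, j) \<in> E r"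
  shows "xin t i j = xout t j i"
  using assms
proof (rule edge_induct)
  fix s assume "(i, j) \<in> E (Suc s)" "xin s i j = xout s j i"
  then show "xin (Suc s) i j = xout (Suc s) j i"
    using edge_update(2)[of "Suc s" i j] edge_update(1)[of "Suc s" j i] E_sym[of i j "Suc s"] by simp
qed simp_all

lemma edge_symmetric:
  assumes "t \<ge> 1" "(i, j) \<in> E t"
  shows "xin t i j = xout t j i" "xin t j i = xout t i j"
  using xin_eq_xout[OF assms(1) _ assms(2)] xin_eq_xout[OF assms(1) _ E_sym[OF assms(2,1)]] by auto

section \<open>Silent edges and the equivalent averaging weights\<close>

lemma msg_zeroD:
  assumes "t \<ge> 1" "(i, j) \<in> E t" "q t i j = 0"
  shows "\<bar>x (t - 1) i - xout t i j\<bar> \<le> c t" "xout t i j = xout (t - 1) i j"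
proof -
  show eq: "xout t i j = xout (t - 1) i j" using edge_update(1)[OF assms(1,2)] assms(3) by simp
  have "\<bar>real t powr \<alpha> * (x (t - 1) i - xout (t - 1) i j)\<bar> \<le> 1"
    using assms(3) unfolding msg_def ternary_def by (auto split: if_splits)
  then show "\<bar>x (t - 1) i - xout t i j\<bar> \<le> c t"
    using assms(1) unfolding eq abs_mult by (simp add: powr_minus pos_le_divide_eq mult.commute divide_inverse[symmetric] inverse_eq_divide)
qed

lemma msg_cases:
  assumes "t \<ge> 1"
  shows "q t i j = (if x (t - 1) i - xout (t - 1) i j > c t then 1
    else if x (t - 1) i - xout (t - 1) i j < - c t then - 1 else 0)"
proof -
  have "real t powr \<alpha> > 0" using assms by simp
  then have "(real t powr \<alpha> * u > 1) = (u > c t)" "(real t powr \<alpha> * u < - 1) = (u < - c t)" for u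
    by (simp_all add: powr_minus_divide pos_divide_less_eq pos_less_minus_divide_eq mult.commute)
  then show ?thesis unfolding msg_def ternary_def by (simp only:)
qed

text \<open>Chosen so that \<open>weight t i j * (x (t - 1) j - x (t - 1) i)\<close> is the
  contribution of \<open>j\<close> to the update of \<open>i\<close>. The difference in the
  denominator is nonzero on active edges by \<open>weight_bounds\<close>.\<close>

definition weight :: "nat \<Rightarrow> nat \<Rightarrow> nat \<Rightarrow> real" where
  "weight t i j = (if j \<in> act i t
     then (xin t i j - xout t i j) / (4 * D i j t * real t powr \<beta> * (x (t - 1) j - x (t - 1) i)) else 0)"

lemma act_edge: "j \<in> act i t \<Longrightarrow> (i, j) \<in> E t"
  unfolding active_def nbrs_def by simp

lemma act_sym:
  assumes "t \<ge> 1" "j \<in> act i t"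
  shows "i \<in> act j t"
proof -
  have e: "(i, j) \<in> E t" by (rule act_edge[OF assms(2)])
  have "xin t j i - xout t j i = - (xin t i j - xout t i j)"
    using edge_symmetric[OF assms(1) e] by simp
  then have "\<bar>xin t j i - xout t j i\<bar> = \<bar>xin t i j - xout t i j\<bar>" by simp
  then show ?thesis
    using assms(2) E_sym[OF e assms(1)] unfolding active_def nbrs_def by simp
qed

lemma nbrs_sub: "t \<ge> 1 \<Longrightarrow> nbrs E i t \<subseteq> {1..n}"
  using E_node unfolding nbrs_def by blast

lemma act_sub: "t \<ge> 1 \<Longrightarrow> act i t \<subseteq> {1..n}"
  using nbrs_sub act_edge unfolding nbrs_def by blast

lemma D_bounds:
  assumes "t \<ge> 1" "(i, j) \<in> E t"
  shows "real (deg E i t) \<le> D i j t" "D i j t \<le> \<D>" "D i j t = D j i t" "1 \<le> D i j t"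
proof -
  show *: "real (deg E i t) \<le> D i j t" "D i j t = D j i t"
    using weights assms unfolding admissible_weights_def by auto
  show "D i j t \<le> \<D>"
    unfolding Dsup_def using weights assms
    by (intro cSup_upper) (auto simp: admissible_weights_def weight_values_def)
  have "j \<in> nbrs E i t" using assms by (simp add: nbrs_def)
  then have "deg E i t \<ge> 1"
    unfolding deg_def using nbrs_sub[OF assms(1), of i] finite_subset[of "nbrs E i t" "{1..n}"]
    by (auto simp: Suc_le_eq card_gt_0_iff)
  then show "1 \<le> D i j t" using *(1) by linarith
qed

lemma Dsup_ge_1: "1 \<le> \<D>"
proof -
  have "(1, 1) \<in> E 1" using graph n_pos unfolding graph_sequence_def by auto
  then show ?thesis using D_bounds(2,4)[of 1 1 1] by simp
qed

text \<open>When both messages vanish, each estimate is within \<open>c t\<close> of its value, so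
  the difference \<open>d\<close> of the estimates and the difference \<open>y\<close> of the values
  are at most \<open>2 * c t\<close> apart, which is less than half of \<open>\<bar>d\<bar>\<close>
  on an active edge. Hence they have the same sign and \<open>d / y\<close> lies between 2/3 and
  2.\<close>

lemma weight_bounds:
  assumes t: "t \<ge> 1" and j: "j \<in> act i t"
  shows "x (t - 1) j \<noteq> x (t - 1) i"
    and "1 / (6 * D i j t * real t powr \<beta>) \<le> weight t i j"
    and "weight t i j \<le> 1 / (2 * D i j t * real t powr \<beta>)"
proof -
  define d where "d = xin t i j - xout t i j"
  define y where "y = x (t - 1) j - x (t - 1) i"
  have edge: "(i, j) \<in> E t" "(j, i) \<in> E t" using act_edge[OF j] E_sym[OF act_edge[OF j] t] by auto
  have q0: "q t i j = 0" "q t j i = 0" and d4: "\<bar>d\<bar> > 4 / real t powr \<alpha>"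
    using j unfolding active_def d_def by auto
  have d4: "\<bar>d\<bar> > 4 * c t" using d4 by (simp add: powr_minus_divide)
  have c0: "0 < c t" using t by simp
  have "\<bar>d - y\<bar> \<le> 2 * c t"
    using msg_zeroD(1)[OF t edge(1) q0(1)] msg_zeroD(1)[OF t edge(2) q0(2)]
      edge_symmetric[OF t edge(1)] unfolding d_def y_def by linarith
  then have yd: "(0 < d \<and> 0 < y \<or> d < 0 \<and> y < 0) \<and> 2 * \<bar>y\<bar> \<le> 3 * \<bar>d\<bar> \<and> \<bar>d\<bar> \<le> 2 * \<bar>y\<bar>"
    using d4 c0 by (auto simp: abs_if split: if_splits)
  then show "x (t - 1) j \<noteq> x (t - 1) i" unfolding y_def by auto
  have ratio: "2 / 3 \<le> d / y" "d / y \<le> 2"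
    using yd by (auto simp: field_simps)
  have pos: "0 < D i j t * real t powr \<beta>" using D_bounds(4)[OF t edge(1)] t by simp
  have w: "weight t i j = d / y / (4 * (D i j t * real t powr \<beta>))"
    using j unfolding weight_def d_def y_def by (simp add: field_simps)
  show "1 / (6 * D i j t * real t powr \<beta>) \<le> weight t i j"
    unfolding w using divide_right_mono[OF ratio(1), of "4 * (D i j t * real t powr \<beta>)"] pos
    by (simp add: mult.assoc)
  show "weight t i j \<le> 1 / (2 * D i j t * real t powr \<beta>)"
    unfolding w using divide_right_mono[OF ratio(2), of "4 * (D i j t * real t powr \<beta>)"] pos
    by (simp add: mult.assoc)
qed

text \<open>Since \<open>D\<close> dominates the degree, each active neighbor has weight at most
  \<open>1 / (2 * deg E i t * real t powr \<beta>)\<close>, and there are at most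
  \<open>deg E i t\<close> of them. The parameter \<open>r\<close> is left free so that all steps of
  a window can share one bound.\<close>

lemma averaging:
  assumes t: "t \<ge> 1" and r: "1 / (2 * real t powr \<beta>) \<le> r" "r \<le> 1 / 2"
  shows "averaging_step {1..n} (weight t) r (x (t - 1)) (x t)"
proof
  show "finite {1..n}" by simp
  show "weight t i j = weight t j i" for i j
  proof (cases "j \<in> act i t")
    case True
    note e = act_edge[OF True]
    show ?thesis
      using True act_sym[OF t True] edge_symmetric[OF t e] D_bounds(3)[OF t e]
      unfolding weight_def by (simp add: divide_simps) (simp add: algebra_simps)
  next
    case False
    then have "i \<notin> act j t" using act_sym[OF t] by blast
    then show ?thesis using False unfolding weight_def by simp
  qed
  show nn: "0 \<le> weight t i j" for i j
  proof (cases "j \<in> act i t")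
    case True
    have "0 \<le> 1 / (6 * D i j t * real t powr \<beta>)"
      using D_bounds(4)[OF t act_edge[OF True]] by simp
    then show ?thesis using weight_bounds(2)[OF t True] by linarith
  qed (simp add: weight_def)
  show "r \<le> 1 / 2" by fact
  fix i assume i: "i \<in> {1..n}"
  have sum_act: "(\<Sum>j\<in>{1..n}. weight t i j * g j) = (\<Sum>j\<in>act i t. weight t i j * g j)" for g
    using act_sub[OF t, of i] by (intro sum.mono_neutral_right) (auto simp: weight_def)
  show "(\<Sum>j\<in>{1..n}. weight t i j) \<le> r"
  proof (cases "act i t = {}")
    case True
    then show ?thesis using r t order_trans[of 0 "1 / (2 * real t powr \<beta>)" r] by (simp add: weight_def)
  next
    case False
    then have deg0: "0 < deg E i t"
      unfolding deg_def using nbrs_sub[OF t, of i] finite_subset[of "nbrs E i t" "{1..n}"]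
      by (auto simp: card_gt_0_iff active_def)
    have "(\<Sum>j\<in>{1..n}. weight t i j) = (\<Sum>j\<in>act i t. weight t i j)"
      using sum_act[of "\<lambda>_. 1"] by simp
    also have "\<dots> \<le> (\<Sum>j\<in>act i t. 1 / (2 * deg E i t * real t powr \<beta>))"
    proof (intro sum_mono order_trans[OF weight_bounds(3)[OF t]])
      fix j assume "j \<in> act i t"
      then show "1 / (2 * D i j t * real t powr \<beta>) \<le> 1 / (2 * deg E i t * real t powr \<beta>)"
        using D_bounds(1,4)[OF t act_edge, of j i] deg0 t
        by (intro divide_left_mono mult_right_mono mult_pos_pos) auto
    qed
    also have "\<dots> = real (card (act i t)) / (2 * deg E i t * real t powr \<beta>)" by simp
    also have "\<dots> \<le> real (deg E i t) / (2 * deg E i t * real t powr \<beta>)"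
    proof (rule divide_right_mono)
      show "real (card (act i t)) \<le> real (deg E i t)"
        unfolding deg_def using nbrs_sub[OF t, of i] finite_subset[of "nbrs E i t" "{1..n}"]
        by (auto intro!: card_mono simp: active_def)
    qed simp
    also have "\<dots> = 1 / (2 * real t powr \<beta>)" using deg0 by simp
    finally show ?thesis using r by simp
  qed
  show "x t i = x (t - 1) i + (\<Sum>j\<in>{1..n}. weight t i j * (x (t - 1) j - x (t - 1) i))"
    unfolding sum_act node_update[OF t i] sum_distrib_left
    using weight_bounds(1)[OF t]
    by (intro arg_cong2[where f = "(+)"] refl sum.cong) (auto simp: weight_def divide_simps)
qed

end

section \<open>Tracking of the values along core edges\<close>

lemma powr_ratio_le:
  fixes a b s :: real
  assumes "0 < a" "a \<le> b" "0 \<le> s" "s \<le> 1"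
  shows "a / b \<le> (a / b) powr s" "(b / a) powr s \<le> b / a"
proof -
  have ab: "0 < a / b" "a / b \<le> 1" "1 \<le> b / a" using assms by auto
  show "a / b \<le> (a / b) powr s" using powr_mono'[of s 1 "a / b"] assms ab by simp
  show "(b / a) powr s \<le> b / a" using powr_mono[of s 1 "b / a"] assms ab by simp
qed

lemma powr_minus_ratio:
  fixes a b s :: real
  assumes "0 < a" "a \<le> b" "0 \<le> s" "s \<le> 1"
  shows "a powr - s * (a / b) \<le> b powr - s"
proof -
  have "b powr - s = a powr - s * (a / b) powr s"
    using assms by (simp add: powr_divide powr_minus field_simps)
  then show ?thesis using powr_ratio_le(1)[OF assms] by (simp only: mult_left_mono powr_ge_zero)
qed

text \<open>This replaces an integral comparison: with \<open>s = 1 - \<alpha>\<close> or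
  \<open>s = 1 - \<beta>\<close>, sums of quanta or of decay rates over consecutive blocks telescope
  to differences of powers.\<close>

lemma powr_diff_le:
  fixes a b s :: real
  assumes "0 < a" "a \<le> b" "0 \<le> s" "s \<le> 1"
  shows "b powr s - a powr s \<le> (b - a) * a powr (s - 1)"
proof -
  have "b powr s = a powr s * (b / a) powr s" using assms by (simp add: powr_divide)
  also have "\<dots> \<le> a powr s * (b / a)" using powr_ratio_le(2)[OF assms] by (intro mult_left_mono) auto
  also have "\<dots> = b * a powr (s - 1)" using assms by (simp add: powr_diff)
  finally have "b powr s \<le> b * a powr (s - 1)" .
  moreover have "a powr s = a * a powr (s - 1)" using assms by (simp add: powr_diff)
  ultimately show ?thesis by (simp add: algebra_simps)
qed

context protocol
begin

abbreviation W :: real where "W \<equiv> spread n (x 0)"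

lemma \<beta>_pos: "0 < \<beta>" and \<alpha>_less_1: "\<alpha> < 1"
  using \<alpha>_pos \<alpha>_less \<beta>_less by auto

lemma averaging_time:
  assumes "t \<ge> 1"
  shows "averaging_step {1..n} (weight t) (1 / (2 * real t powr \<beta>)) (x (t - 1)) (x t)"
proof -
  have "1 \<le> real t powr \<beta>" using assms \<beta>_pos by (intro ge_one_powr_ge_zero) auto
  then show ?thesis using assms by (intro averaging) auto
qed

lemma x_range:
  assumes "i \<in> {1..n}"
  shows "Min (x 0 ` {1..n}) \<le> x t i \<and> x t i \<le> Max (x 0 ` {1..n})"
  using assms
proof (induction t arbitrary: i)
  case (Suc t)
  interpret averaging_step "{1..n}" "weight (Suc t)" "1 / (2 * real (Suc t) powr \<beta>)" "x t" "x (Suc t)"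
    using averaging_time[of "Suc t"] by simp
  show ?case using range_step(1,2)[OF Suc.prems Suc.IH] by blast
qed simp

lemma W_nonneg: "0 \<le> W"
  using x_range[of 1 0] n_pos unfolding spread_def by auto

lemma x_step:
  assumes "t \<ge> 1" "i \<in> {1..n}"
  shows "\<bar>x t i - x (t - 1) i\<bar> \<le> W / (2 * real t powr \<beta>)"
  using averaging_step.range_step(3)[OF averaging_time[OF assms(1)] assms(2) x_range]
  unfolding spread_def by simp

lemma x_bound:
  assumes "i \<in> {1..n}"
  shows "\<bar>x t i\<bar> \<le> M"
proof -
  have "- M \<le> x 0 j" "x 0 j \<le> M" if "j \<in> {1..n}" for j
  proof -
    have "\<bar>x 0 j\<bar> \<le> M" unfolding sup_norm_def using that by (intro Max_ge) auto
    then show "- M \<le> x 0 j" "x 0 j \<le> M" by linarith+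
  qed
  then have "- M \<le> Min (x 0 ` {1..n})" "Max (x 0 ` {1..n}) \<le> M"
    using n_pos by auto
  then show ?thesis using x_range[OF assms, of t] by linarith
qed

lemma M_nonneg: "0 \<le> M"
  using x_bound[of 1 0] n_pos by auto

abbreviation avg :: real where "avg \<equiv> 1 / real n * (\<Sum>j=1..n. x 0 j)"

lemma sum_x: "(\<Sum>j=1..n. x t j) = (\<Sum>j=1..n. x 0 j)"
proof (induction t)
  case (Suc t)
  then show ?case using averaging_step.sum_preserved[OF averaging_time[of "Suc t"]] by simp
qed simp

lemma V2_sq: "(V2 n (x t))\<^sup>2 = (\<Sum>i=1..n. (x t i - avg)\<^sup>2)"
  unfolding V2_def sum_x[of t] by (simp add: sum_nonneg)

lemma V2_nonneg: "0 \<le> V2 n v"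
  unfolding V2_def by (simp add: sum_nonneg)

lemma V2_antimono:
  assumes "s \<le> t"
  shows "V2 n (x t) \<le> V2 n (x s)"
  using assms
proof (induction rule: dec_induct)
  case (step m)
  interpret averaging_step "{1..n}" "weight (Suc m)" "1 / (2 * real (Suc m) powr \<beta>)" "x m" "x (Suc m)"
    using averaging_time[of "Suc m"] by simp
  have "(V2 n (x (Suc m)))\<^sup>2 \<le> (V2 n (x m))\<^sup>2"
    using sum_sq_dist[of avg] energy_nonneg unfolding V2_sq by simp
  then have "V2 n (x (Suc m)) \<le> V2 n (x m)" by (rule power2_le_imp_le) (rule V2_nonneg)
  then show ?case using step.IH by simp
qed simp

section \<open>Error of the estimates and its drift\<close>

definition gap :: "nat \<Rightarrow> nat \<Rightarrow> nat \<Rightarrow> real" where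
  "gap t i j = x t i - xout t i j"

lemma msg_zero_iff: "t \<ge> 1 \<Longrightarrow> q t i j = 0 \<longleftrightarrow> \<bar>gap (t - 1) i j\<bar> \<le> c t"
  using powr_ge_zero[of "real t" "- \<alpha>"] msg_cases[of t i j] unfolding gap_def abs_le_iff by argo

text \<open>A message is sent only if the absolute gap exceeds the quantum, and it has the sign of
  the gap, so it never overshoots: the absolute gap falls by exactly one quantum before the value
  itself moves.\<close>

lemma gap_edge:
  assumes "t \<ge> 1" "(i, j) \<in> E t"
  shows "\<bar>gap t i j\<bar> \<le> \<bar>gap (t - 1) i j\<bar> - \<bar>q t i j\<bar> * c t + \<bar>x t i - x (t - 1) i\<bar>"
proof -
  have "gap t i j = gap (t - 1) i j - q t i j * c t + (x t i - x (t - 1) i)"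
    unfolding gap_def edge_update(1)[OF assms] by simp
  moreover have "\<bar>gap (t - 1) i j - q t i j * c t\<bar> = \<bar>gap (t - 1) i j\<bar> - \<bar>q t i j\<bar> * c t"
    using powr_ge_zero[of "real t" "- \<alpha>"] unfolding msg_cases[OF assms(1)] gap_def by (auto simp del: powr_ge_zero)
  ultimately show ?thesis by linarith
qed

lemma gap_step:
  assumes "1 \<le> r" "r \<le> t" "(i, j) \<in> E r"
  shows "\<bar>gap t i j\<bar> \<le> \<bar>gap (t - 1) i j\<bar> + \<bar>x t i - x (t - 1) i\<bar>"
proof (cases "(i, j) \<in> E t")
  case True
  have "0 \<le> \<bar>q t i j\<bar> * c t" by simp
  then show ?thesis using gap_edge[of t i j] True assms by linarith
next
  case False
  then have "r < t" using assms by (metis le_neq_implies_less)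
  then have "xout t i j = xout (t - 1) i j" using no_edge_update(1)[of t i j r] False assms by simp
  then show ?thesis unfolding gap_def by simp
qed

text \<open>A message moves the estimate toward \<open>x s i\<close> by less than their distance,
  and \<open>x s i\<close> lies between \<open>- M\<close> and \<open>M\<close>, so the estimate
  cannot leave that interval.\<close>

lemma xout_bound:
  assumes "1 \<le> r" "r \<le> Suc t" "(i, j) \<in> E r"
  shows "\<bar>xout t i j\<bar> \<le> M"
  using assms
proof (rule edge_induct)
  fix s assume e: "(i, j) \<in> E (Suc s)" and IH: "\<bar>xout s i j\<bar> \<le> M"
  have x: "\<bar>x s i\<bar> \<le> M" using x_bound E_node[OF e] by simp
  have c0: "0 \<le> c (Suc s)" by simp
  have "xout (Suc s) i j = xout s i j + q (Suc s) i j * c (Suc s)"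
    using edge_update(1)[OF _ e] by simp
  also have "q (Suc s) i j = (if x s i - xout s i j > c (Suc s) then 1
      else if x s i - xout s i j < - c (Suc s) then - 1 else 0)"
    using msg_cases[of "Suc s" i j] unfolding diff_Suc_1 by simp
  finally have "xout (Suc s) i j = (if x s i - xout s i j > c (Suc s) then xout s i j + c (Suc s)
      else if x s i - xout s i j < - c (Suc s) then xout s i j - c (Suc s) else xout s i j)"
    by (simp split: if_splits)
  then consider "x s i - xout s i j > c (Suc s)" "xout (Suc s) i j = xout s i j + c (Suc s)"
    | "x s i - xout s i j < - c (Suc s)" "xout (Suc s) i j = xout s i j - c (Suc s)"
    | "xout (Suc s) i j = xout s i j"
    by metis
  then show "\<bar>xout (Suc s) i j\<bar> \<le> M"
    using IH x c0 by cases linarith+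
qed (auto simp: M_nonneg)

definition core :: "nat \<Rightarrow> nat \<Rightarrow> bool" where
  "core i j \<longleftrightarrow> (\<forall>k. \<exists>t\<in>{k * B + 1..(k + 1) * B}. (i, j) \<in> E t)"

lemma core_F: "(i, j) \<in> F \<Longrightarrow> core i j"
  using F_block unfolding core_def by blast

lemma coreE:
  assumes "core i j"
  obtains s where "k * B < s" "s \<le> (k + 1) * B" "(i, j) \<in> E s"
proof -
  obtain s where "s \<in> {k * B + 1..(k + 1) * B}" "(i, j) \<in> E s"
    using assms unfolding core_def by blast
  then show thesis using that[of s] by simp
qed

lemma core_sym:
  assumes "core i j"
  shows "core j i"
  unfolding core_def
proof
  fix k
  obtain s where "k * B < s" "s \<le> (k + 1) * B" "(i, j) \<in> E s" using coreE[OF assms] .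
  then show "\<exists>t\<in>{k * B + 1..(k + 1) * B}. (j, i) \<in> E t"
    using E_sym[of i j s] by (intro bexI[of _ s]) auto
qed

lemma core_node:
  assumes "core i j"
  shows "i \<in> {1..n}" "j \<in> {1..n}"
proof -
  obtain s where "0 * B < s" "s \<le> (0 + 1) * B" "(i, j) \<in> E s" using coreE[OF assms] .
  then show "i \<in> {1..n}" "j \<in> {1..n}" using E_node[of i j s] by auto
qed

text \<open>The summand with \<open>W\<close> keeps one step within
  \<open>c t / (16 * real B)\<close>, so that a block of \<open>B\<close> steps drifts by at most a
  sixteenth of a quantum. The summand \<open>32 * real B\<close> provides the lower bound on
  \<open>real t powr \<beta>\<close> in \<open>window_energy\<close>.\<close>

definition late :: "nat \<Rightarrow> bool" where
  "late t \<longleftrightarrow> t \<ge> 1 \<and> 32 * real B + 8 * real B * W \<le> real t powr (\<beta> - \<alpha>)"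

lemma late_mono:
  assumes "late s" "s \<le> t"
  shows "late t"
proof -
  have "real s powr (\<beta> - \<alpha>) \<le> real t powr (\<beta> - \<alpha>)"
    using assms \<alpha>_less by (intro powr_mono2) auto
  then show ?thesis using assms unfolding late_def by auto
qed

lemma c_antimono: "1 \<le> s \<Longrightarrow> s \<le> t \<Longrightarrow> c t \<le> c s"
  using \<alpha>_pos by (intro powr_mono2') auto

lemma late_step:
  assumes "late t" "i \<in> {1..n}"
  shows "\<bar>x t i - x (t - 1) i\<bar> \<le> c t / (16 * real B)"
proof -
  have t: "t \<ge> 1" using assms by (simp add: late_def)
  have "32 * real B + 8 * (real B * W) \<le> real t powr (\<beta> - \<alpha>)"
    using assms unfolding late_def by (simp add: mult.assoc)
  then have "16 * (real B * W) \<le> 2 * real t powr (\<beta> - \<alpha>)" by linarith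
  then have "W * (16 * real B) \<le> 2 * real t powr (\<beta> - \<alpha>)" by (simp add: mult_ac)
  then have "W * (16 * real B) * c t \<le> 2 * real t powr (\<beta> - \<alpha>) * c t"
    by (intro mult_right_mono) auto
  also have "\<dots> = c t * 2 * (real t powr \<beta> * c t)"
    using t by (simp add: powr_diff powr_minus field_simps)
  finally have "W * (16 * real B) \<le> c t * (2 * real t powr \<beta>)"
    using t by (simp add: mult_ac)
  then have "W / (2 * real t powr \<beta>) \<le> c t / (16 * real B)"
    using t B_pos by (simp add: field_simps)
  then show ?thesis using x_step[OF t assms(2)] by linarith
qed

lemma gap_drift:
  assumes late: "late t0" and r: "1 \<le> r" "r \<le> t0" "(i, j) \<in> E r" and t: "t0 \<le> t"
  shows "\<bar>gap t i j\<bar> \<le> \<bar>gap t0 i j\<bar> + (real t - real t0) * (c t0 / (16 * real B))"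
    (is "_ \<le> _ + _ * ?\<delta>")
  using t
proof (induction t rule: dec_induct)
  case (step m)
  have "\<bar>x (Suc m) i - x m i\<bar> \<le> c (Suc m) / (16 * real B)"
    using late_step[of "Suc m" i] late_mono[OF late, of "Suc m"] step.hyps E_node[OF r(3,1)] by simp
  also have "\<dots> \<le> c t0 / (16 * real B)"
    using c_antimono[of t0 "Suc m"] step.hyps late by (intro divide_right_mono) (auto simp: late_def)
  finally have "\<bar>gap (Suc m) i j\<bar> \<le> \<bar>gap m i j\<bar> + c t0 / (16 * real B)"
    using gap_step[of r "Suc m" i j] r step.hyps by simp
  moreover have "(real (Suc m) - real t0) * ?\<delta> = (real m - real t0) * ?\<delta> + ?\<delta>"
    unfolding of_nat_Suc left_diff_distrib distrib_right by linarith
  ultimately show ?case using step.IH by linarith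
qed simp

text \<open>The drift is counted from \<open>s - 1\<close>, so it includes the movement in step
  \<open>s\<close> itself and joins the drift before \<open>s - 1\<close> without a
  remainder.\<close>

lemma gap_event:
  assumes late: "late t0" and r: "1 \<le> r" "r \<le> t0" "(i, j) \<in> E r"
    and s: "t0 < s" "(i, j) \<in> E s" "s \<le> t"
  shows "\<bar>gap t i j\<bar> \<le> \<bar>gap (s - 1) i j\<bar> - \<bar>q s i j\<bar> * c s + (real t - real (s - 1)) * (c t0 / (16 * real B))"
proof -
  have ls: "late s" using late_mono[OF late] s by simp
  have c: "c s \<le> c t0" using c_antimono[of t0 s] s late by (simp add: late_def)
  have "\<bar>gap s i j\<bar> \<le> \<bar>gap (s - 1) i j\<bar> - \<bar>q s i j\<bar> * c s + c s / (16 * real B)"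
    using gap_edge[of s i j] late_step[OF ls, of i] E_node[OF r(3,1)] s by auto
  moreover have "\<bar>gap t i j\<bar> \<le> \<bar>gap s i j\<bar> + (real t - real s) * (c s / (16 * real B))"
    using gap_drift[OF ls r(1) _ r(3) s(3)] r s by simp
  moreover have "(1 + real t - real s) * (c s / (16 * real B)) \<le> (1 + real t - real s) * (c t0 / (16 * real B))"
    using c s by (intro mult_left_mono divide_right_mono) auto
  moreover have "(1 + real t - real s) * (c s / (16 * real B))
      = c s / (16 * real B) + (real t - real s) * (c s / (16 * real B))"
    by (simp only: distrib_right left_diff_distrib)
  moreover have "real t - real (s - 1) = 1 + real t - real s" using s by simp
  ultimately show ?thesis by (simp only:)
qed

section \<open>Tracking and its persistence from block to block\<close>

abbreviation tracked :: "nat \<Rightarrow> nat \<Rightarrow> nat \<Rightarrow> bool" where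
  "tracked k i j \<equiv> \<bar>gap (k * B) i j\<bar> \<le> 9 / 8 * c (k * B)"

lemma c_block:
  assumes "32 \<le> k"
  shows "32 / 33 * c (k * B) \<le> c ((k + 1) * B)" "32 / 35 * c (k * B) \<le> c ((k + 3) * B)"
proof -
  have "c (k * B) * (real (k * B) / real ((k + d) * B)) \<le> c ((k + d) * B)" for d
    using assms B_pos \<alpha>_pos \<alpha>_less_1 by (intro powr_minus_ratio) auto
  moreover have "real (k * B) / real ((k + d) * B) = real k / real (k + d)" for d
    using B_pos by simp
  ultimately have *: "c (k * B) * (real k / real (k + d)) \<le> c ((k + d) * B)" for d
    by metis
  have "32 / 33 \<le> real k / real (k + 1)" "32 / 35 \<le> real k / real (k + 3)"
    using assms by (auto simp: field_simps)
  then have "c (k * B) * (32 / 33) \<le> c (k * B) * (real k / real (k + 1))"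
    "c (k * B) * (32 / 35) \<le> c (k * B) * (real k / real (k + 3))"
    by (intro mult_left_mono; simp)+
  then show "32 / 33 * c (k * B) \<le> c ((k + 1) * B)" "32 / 35 * c (k * B) \<le> c ((k + 3) * B)"
    using *[of 1] *[of 3] by linarith+
qed

lemma core_before:
  assumes "core i j" "1 \<le> k"
  obtains r where "1 \<le> r" "r \<le> k * B" "(i, j) \<in> E r"
proof -
  obtain r where "0 * B < r" "r \<le> (0 + 1) * B" "(i, j) \<in> E r" using coreE[OF assms(1)] .
  then have r: "1 \<le> r" "r \<le> B" "(i, j) \<in> E r" by simp_all
  moreover have "B \<le> k * B" using assms(2) by simp
  ultimately have "r \<le> k * B" by linarith
  then show thesis using that[of r] r by blast
qed

text \<open>The edge occurs at some \<open>s\<close> in the block. If no message is sent there, the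
  gap was at most one quantum and drift adds 1/16. Otherwise the gap loses \<open>c s\<close>, at
  least 32/33 of the quantum at the start of the block, and 32/33 - 1/16 exceeds 9/10.\<close>

lemma block_step:
  assumes core: "core i j" and k: "32 \<le> k" and late: "late (k * B)"
  shows "\<bar>gap ((k + 1) * B) i j\<bar> \<le> 17 / 16 * c (k * B) \<or>
    \<bar>gap ((k + 1) * B) i j\<bar> \<le> \<bar>gap (k * B) i j\<bar> - 9 / 10 * c (k * B)"
proof -
  let ?C = "c (k * B)" and ?\<delta> = "c (k * B) / (16 * real B)"
  obtain r where r: "1 \<le> r" "r \<le> k * B" "(i, j) \<in> E r" using core_before[OF core, of k] k by auto
  obtain s where s: "k * B < s" "s \<le> (k + 1) * B" "(i, j) \<in> E s" using coreE[OF core] .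
  have ev: "\<bar>gap ((k + 1) * B) i j\<bar> \<le> \<bar>gap (s - 1) i j\<bar> - \<bar>q s i j\<bar> * c s
      + (real ((k + 1) * B) - real (s - 1)) * ?\<delta>"
    by (rule gap_event[OF late r s(1,3,2)])
  have before: "\<bar>gap (s - 1) i j\<bar> \<le> \<bar>gap (k * B) i j\<bar> + (real (s - 1) - real (k * B)) * ?\<delta>"
    using gap_drift[OF late r, of "s - 1"] s by simp
  have B\<delta>: "real B * ?\<delta> = ?C / 16" using B_pos by simp
  have cs: "c s \<le> ?C" "c ((k + 1) * B) \<le> c s"
    using late s by (auto simp: late_def simp del: of_nat_mult of_nat_add intro!: c_antimono)
  show ?thesis
  proof (cases "q s i j = 0")
    case True
    then have "\<bar>gap (s - 1) i j\<bar> \<le> c s" using msg_zero_iff[of s i j] s by simp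
    moreover have "(real ((k + 1) * B) - real (s - 1)) * ?\<delta> \<le> real B * ?\<delta>"
    proof (rule mult_right_mono)
      have "real (k * B) \<le> real (s - 1)" using s(1) by (intro of_nat_mono) linarith
      then show "real ((k + 1) * B) - real (s - 1) \<le> real B" by (simp add: algebra_simps)
    qed simp
    ultimately show ?thesis using ev True cs B\<delta> by simp
  next
    case False
    then have "\<bar>q s i j\<bar> = 1" unfolding msg_def ternary_def by (auto split: if_splits)
    then have "\<bar>q s i j\<bar> * c s = c s" by simp
    then have "\<bar>gap ((k + 1) * B) i j\<bar> \<le> \<bar>gap (k * B) i j\<bar> - c s + (real ((k + 1) * B) - real (k * B)) * ?\<delta>"
      using ev before unfolding left_diff_distrib by linarith
    also have "(real ((k + 1) * B) - real (k * B)) * ?\<delta> = ?C / 16"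
      unfolding B\<delta>[symmetric] by (simp add: algebra_simps)
    finally show ?thesis using c_block(1)[OF k] cs powr_ge_zero[of "real (k * B)" "- \<alpha>"] by linarith
  qed
qed

text \<open>The threshold 9/8 is stable although the quantum shrinks: both 17/16 and 9/8 - 9/10 are
  below 32/33 times 9/8.\<close>

lemma tracked_Suc:
  assumes core: "core i j" and k: "32 \<le> k" and late: "late (k * B)"
    and "tracked k i j \<or> \<bar>gap ((k + 1) * B) i j\<bar> \<le> 17 / 16 * c (k * B)"
  shows "tracked (k + 1) i j"
  using block_step[OF core k late] assms(4) c_block(1)[OF k] powr_ge_zero[of "real (k * B)" "- \<alpha>"]
  by linarith

lemma tracked_mono:
  assumes core: "core i j" and k: "32 \<le> k" and late: "late (k * B)" and "tracked k i j" "k \<le> l"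
  shows "tracked l i j"
  using assms(5)
proof (induction l rule: dec_induct)
  case (step l)
  have "late (l * B)" using late_mono[OF late] step.hyps by simp
  then show ?case using tracked_Suc[OF core, of l] step k by simp
qed (rule assms(4))

text \<open>Until the edge is tracked, each block removes 9/10 of a quantum from a gap that starts
  at no more than \<open>2 * M\<close>. The removed amounts telescope by \<open>powr_diff_le\<close>
  and, by the last hypothesis, reach at least \<open>2.7 * M\<close>.\<close>

lemma tracked_eventually:
  assumes core: "core i j" and m: "32 \<le> m" and late: "late (m * B)" and "m \<le> k"
    and sum: "3 * real B * M \<le> real (k * B) powr (1 - \<alpha>) - real (m * B) powr (1 - \<alpha>)"
  shows "tracked k i j"
proof -
  have "tracked l i j \<or> \<bar>gap (l * B) i j\<bar>
      \<le> 2 * M - 9 / 10 * ((real (l * B) powr (1 - \<alpha>) - real (m * B) powr (1 - \<alpha>)) / real B)"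
    if "m \<le> l" for l
    using that
  proof (induction l rule: dec_induct)
    case base
    obtain r where "1 \<le> r" "r \<le> m * B" "(i, j) \<in> E r" using core_before[OF core, of m] m by auto
    then have "\<bar>xout (m * B) i j\<bar> \<le> M" by (intro xout_bound) auto
    then show ?case using x_bound[of i "m * B"] core_node[OF core] unfolding gap_def by auto
  next
    case (step l)
    have l: "32 \<le> l" "late (l * B)" using step.hyps m late_mono[OF late] by auto
    show ?case
    proof (cases "tracked (Suc l) i j")
      case False
      \<comment> \<open>Being untracked at the end of the block excludes both being tracked at its
        start and the first alternative of \<open>block_step\<close>.\<close>
      then have "\<not> tracked l i j" "\<bar>gap (Suc l * B) i j\<bar> \<le> \<bar>gap (l * B) i j\<bar> - 9 / 10 * c (l * B)"
        using tracked_Suc[OF core l] block_step[OF core l] by auto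
      moreover have "real (Suc l * B) powr (1 - \<alpha>) - real (l * B) powr (1 - \<alpha>)
          \<le> (real (Suc l * B) - real (l * B)) * real (l * B) powr (1 - \<alpha> - 1)"
        using l B_pos \<alpha>_pos \<alpha>_less_1 by (intro powr_diff_le) auto
      then have "(real (Suc l * B) powr (1 - \<alpha>) - real (l * B) powr (1 - \<alpha>)) / real B \<le> c (l * B)"
        using B_pos by (simp add: field_simps)
      ultimately have "\<bar>gap (Suc l * B) i j\<bar>
          \<le> 2 * M - 9 / 10 * ((real (Suc l * B) powr (1 - \<alpha>) - real (m * B) powr (1 - \<alpha>)) / real B)"
        using step.IH unfolding diff_divide_distrib by argo
      then show ?thesis ..
    qed simp
  qed
  then have "tracked k i j \<or> \<bar>gap (k * B) i j\<bar>
      \<le> 2 * M - 9 / 10 * ((real (k * B) powr (1 - \<alpha>) - real (m * B) powr (1 - \<alpha>)) / real B)"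
    using assms by simp
  moreover have "3 * M \<le> (real (k * B) powr (1 - \<alpha>) - real (m * B) powr (1 - \<alpha>)) / real B"
    using sum B_pos by (simp add: field_simps)
  ultimately show ?thesis using M_nonneg powr_ge_zero[of "real (k * B)" "- \<alpha>"] by linarith
qed

text \<open>After a nonzero message the gap is so small that three further blocks of drift cannot
  trigger another one.\<close>

lemma message_once:
  assumes core: "core i j" and k: "32 \<le> k" and late: "late (k * B)" and tr: "tracked k i j"
    and s: "k * B < s" "s < s'" "s' \<le> (k + 3) * B" and e: "(i, j) \<in> E s" and qs: "q s i j \<noteq> 0"
  shows "q s' i j = 0"
proof -
  let ?C = "c (k * B)" and ?\<delta> = "c (k * B) / (16 * real B)"
  obtain r where r: "1 \<le> r" "r \<le> k * B" "(i, j) \<in> E r" using core_before[OF core, of k] k by auto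
  have "\<bar>q s i j\<bar> = 1" using qs unfolding msg_def ternary_def by (auto split: if_splits)
  moreover have "s \<le> s' - 1" using s by simp
  ultimately have "\<bar>gap (s' - 1) i j\<bar> \<le> \<bar>gap (s - 1) i j\<bar> - c s + (real (s' - 1) - real (s - 1)) * ?\<delta>"
    using gap_event[OF late r s(1) e] by simp
  moreover have "\<bar>gap (s - 1) i j\<bar> \<le> \<bar>gap (k * B) i j\<bar> + (real (s - 1) - real (k * B)) * ?\<delta>"
    using gap_drift[OF late r, of "s - 1"] s by simp
  ultimately have "\<bar>gap (s' - 1) i j\<bar> \<le> \<bar>gap (k * B) i j\<bar> - c s + (real (s' - 1) - real (k * B)) * ?\<delta>"
    unfolding left_diff_distrib by linarith
  also have "(real (s' - 1) - real (k * B)) * ?\<delta> \<le> (3 * real B) * ?\<delta>"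
  proof (rule mult_right_mono)
    have "real (s' - 1) \<le> real ((k + 3) * B)" using s by (intro of_nat_mono) simp
    then show "real (s' - 1) - real (k * B) \<le> 3 * real B" by (simp add: algebra_simps)
  qed simp
  also have "\<dots> = 3 / 16 * ?C" using B_pos by simp
  \<comment> \<open>Here 21/16 is 9/8 + 3/16. Both \<open>c s\<close> and \<open>c s'\<close> are at
    least 32/35 of \<open>?C\<close>, and 64/35 exceeds 21/16.\<close>
  finally have "\<bar>gap (s' - 1) i j\<bar> \<le> 21 / 16 * ?C - c s" using tr by linarith
  moreover have "c ((k + 3) * B) \<le> c s" "c ((k + 3) * B) \<le> c s'"
    using s by (auto simp del: of_nat_mult intro!: c_antimono)
  ultimately have "\<bar>gap (s' - 1) i j\<bar> \<le> c s'"
    using c_block(2)[OF k] powr_ge_zero[of "real (k * B)" "- \<alpha>"] by linarith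
  then show ?thesis using msg_zero_iff[of s'] s by simp
qed

text \<open>Pigeonhole: the edge occurs in each of three successive blocks, and by
  \<open>message_once\<close> each of its two directions sends a nonzero message at no more than one
  of these occurrences.\<close>

lemma quiet_time:
  assumes core: "core i j" and k: "32 \<le> k" and late: "late (k * B)"
    and tr: "tracked k i j" "tracked k j i"
  obtains s where "k * B < s" "s \<le> (k + 3) * B" "(i, j) \<in> E s" "q s i j = 0" "q s j i = 0"
proof -
  obtain s1 where s1: "k * B < s1" "s1 \<le> (k + 1) * B" "(i, j) \<in> E s1" using coreE[OF core] .
  obtain s2 where s2: "(k + 1) * B < s2" "s2 \<le> (k + 1 + 1) * B" "(i, j) \<in> E s2" using coreE[OF core] .
  obtain s3 where s3: "(k + 2) * B < s3" "s3 \<le> (k + 2 + 1) * B" "(i, j) \<in> E s3" using coreE[OF core] .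
  have ord: "s1 < s2" "s2 < s3" "s1 \<le> (k + 3) * B" "s2 \<le> (k + 3) * B" "s3 \<le> (k + 3) * B"
    "k * B < s2" "k * B < s3"
    using s1 s2 s3 by (auto simp: algebra_simps)
  have e: "(j, i) \<in> E s1" "(j, i) \<in> E s2" using s1 s2 by (auto intro!: E_sym)
  note m1 = message_once[OF core k late tr(1)] message_once[OF core_sym[OF core] k late tr(2)]
  show thesis
  proof (cases "q s1 i j = 0 \<and> q s1 j i = 0")
    case True
    then show thesis using that s1 ord by blast
  next
    case no1: False
    show thesis
    proof (cases "q s2 i j = 0 \<and> q s2 j i = 0")
      case True
      then show thesis using that s2 ord by blast
    next
      case False
      have "q s3 i j = 0" "q s3 j i = 0"
        using no1 False m1 s1 s2 ord e by (meson order.strict_trans)+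
      then show thesis using that s3 ord by blast
    qed
  qed
qed

end

section \<open>Decay of the deviation from the mean\<close>

context protocol
begin

text \<open>Popoviciu's inequality: the mean minimizes the sum of squared deviations, and every
  value is within half the range of the midpoint.\<close>

lemma V2_le_spread:
  obtains a b where "a \<in> {1..n}" "b \<in> {1..n}" "0 \<le> x t a - x t b"
    "(V2 n (x t))\<^sup>2 \<le> real n / 4 * (x t a - x t b)\<^sup>2"
proof -
  have ne: "x t ` {1..n} \<noteq> {}" using n_pos by simp
  obtain a where a: "a \<in> {1..n}" "x t a = Max (x t ` {1..n})"
    using Max_in[OF _ ne] by (metis finite_atLeastAtMost finite_imageI imageE)
  obtain b where b: "b \<in> {1..n}" "x t b = Min (x t ` {1..n})"
    using Min_in[OF _ ne] by (metis finite_atLeastAtMost finite_imageI imageE)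
  have ab: "x t b \<le> x t i" "x t i \<le> x t a" if "i \<in> {1..n}" for i
    unfolding a b using that by (auto intro!: Min_le Max_ge)
  define mid where "mid = (x t a + x t b) / 2"
  have sum: "(\<Sum>i=1..n. x t i) = real n * avg" unfolding sum_x[of t] using n_pos by simp
  have "(\<Sum>i=1..n. (x t i - mid)\<^sup>2) = (\<Sum>i=1..n. (x t i - avg)\<^sup>2 + 2 * (avg - mid) * x t i + (mid\<^sup>2 - avg\<^sup>2))"
    by (intro sum.cong refl) (simp add: power2_eq_square algebra_simps)
  also have "\<dots> = (V2 n (x t))\<^sup>2 + 2 * (avg - mid) * (real n * avg) + real n * (mid\<^sup>2 - avg\<^sup>2)"
    unfolding sum.distrib V2_sq sum_distrib_left[symmetric] sum by simp
  also have "\<dots> = (V2 n (x t))\<^sup>2 + real n * (avg - mid)\<^sup>2"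
    by (simp add: power2_eq_square algebra_simps)
  finally have "(V2 n (x t))\<^sup>2 \<le> (\<Sum>i=1..n. (x t i - mid)\<^sup>2)" by simp
  also have "\<dots> \<le> (\<Sum>i=1..n. ((x t a - x t b) / 2)\<^sup>2)"
  proof (intro sum_mono abs_le_square_iff[THEN iffD1])
    fix i assume "i \<in> {1..n}"
    then show "\<bar>x t i - mid\<bar> \<le> \<bar>(x t a - x t b) / 2\<bar>"
      using ab[of i] unfolding mid_def by (simp add: abs_le_iff field_simps)
  qed
  also have "\<dots> = real n / 4 * (x t a - x t b)\<^sup>2" by (simp add: power_divide)
  finally show thesis using that a b ab[of b] by auto
qed

lemma dist_avg_le_V2:
  assumes "i \<in> {1..n}"
  shows "\<bar>x t i - avg\<bar> \<le> V2 n (x t)"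
proof -
  have "(x t i - avg)\<^sup>2 \<le> (V2 n (x t))\<^sup>2"
    unfolding V2_sq using assms by (intro member_le_sum[where f = "\<lambda>i. (x t i - avg)\<^sup>2"]) auto
  then show ?thesis using V2_nonneg by (simp add: abs_le_square_iff[symmetric])
qed

text \<open>The hypothesis on \<open>V2\<close> makes the spread so large that the inactive core edges, across which
  the values differ by at most \<open>6 * c (k * B)\<close>, cannot account for it alone.\<close>

lemma window_energy:
  assumes k: "32 \<le> k" and late: "late (k * B)"
    and tr: "\<And>i j. core i j \<Longrightarrow> tracked k i j"
    and big: "7 * real n powr 1.5 * c (k * B) < V2 n (x (k * B))"
  shows "(V2 n (x (k * B)))\<^sup>2 \<le> 12.5 * (real n)\<^sup>2 * (\<D> * real ((k + 3) * B) powr \<beta>)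
    * ((V2 n (x (k * B)))\<^sup>2 - (V2 n (x ((k + 3) * B)))\<^sup>2)"
proof -
  define t0 where "t0 = k * B"
  define X where "X = \<D> * real ((k + 3) * B) powr \<beta>"
  define r where "r = 1 / (2 * real t0 powr \<beta>)"
  have t0: "t0 \<ge> 1" and t01: "t0 + 3 * B = (k + 3) * B"
    using k B_pos unfolding t0_def by (auto simp: algebra_simps)
  have t0\<beta>: "32 * real B \<le> real t0 powr \<beta>"
  proof -
    have "32 * real B \<le> 32 * real B + 8 * real B * W" using W_nonneg by simp
    also have "\<dots> \<le> real t0 powr (\<beta> - \<alpha>)" using late unfolding late_def t0_def by simp
    also have "\<dots> \<le> real t0 powr \<beta>" using t0 \<alpha>_pos by (intro powr_mono) auto
    finally show ?thesis .
  qed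
  have X32: "32 \<le> X"
  proof -
    have "32 \<le> real t0 powr \<beta>" using t0\<beta> B_pos by linarith
    also have "\<dots> \<le> real ((k + 3) * B) powr \<beta>"
      using \<beta>_pos t01 by (intro powr_mono2) (auto simp del: of_nat_mult)
    also have "\<dots> \<le> X" unfolding X_def using Dsup_ge_1 by (simp add: mult_le_cancel_right1)
    finally show ?thesis .
  qed
  interpret aw: averaging_window "{1..n}" "\<lambda>\<tau>. weight (Suc (t0 + \<tau>))" r "\<lambda>\<tau>. x (t0 + \<tau>)" "3 * B"
  proof (rule averaging_window.intro)
    fix \<tau> assume "\<tau> < 3 * B"
    have "real t0 powr \<beta> \<le> real (Suc (t0 + \<tau>)) powr \<beta>" using \<beta>_pos by (intro powr_mono2) auto
    then have "1 / (2 * real (Suc (t0 + \<tau>)) powr \<beta>) \<le> r"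
      unfolding r_def using t0 by (intro divide_left_mono mult_pos_pos) auto
    moreover have "r \<le> 1 / 2" unfolding r_def using t0\<beta> B_pos by (simp add: divide_le_eq)
    ultimately show "averaging_step {1..n} (weight (Suc (t0 + \<tau>))) r (x (t0 + \<tau>)) (x (t0 + Suc \<tau>))"
      using averaging[of "Suc (t0 + \<tau>)" r] by simp
  qed simp
  obtain a b where ab: "a \<in> {1..n}" "b \<in> {1..n}" "0 \<le> x t0 a - x t0 b"
    and V2y: "(V2 n (x t0))\<^sup>2 \<le> real n / 4 * (x t0 a - x t0 b)\<^sup>2"
    by (rule V2_le_spread)
  define y where "y = x t0 a - x t0 b"
  have n0: "0 < real n" using n_pos by simp
  \<comment> \<open>\<open>V2\<close> is at most \<open>sqrt n / 2\<close> times the range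
    \<open>y\<close>; dividing \<open>7 * n powr 1.5\<close> by that factor gives 14 times
    \<open>n\<close>.\<close>
  have y14: "14 * real n * c t0 < y"
  proof (rule power2_less_imp_less)
    have "(7 * real n powr 1.5 * c t0)\<^sup>2 < (V2 n (x t0))\<^sup>2"
      using big unfolding t0_def by (intro power_strict_mono) auto
    also have "\<dots> \<le> real n / 4 * y\<^sup>2" using V2y unfolding y_def .
    finally have "49 * (real n powr 1.5)\<^sup>2 * (c t0)\<^sup>2 < real n / 4 * y\<^sup>2" by (simp add: power_mult_distrib)
    moreover have "(real n powr 1.5)\<^sup>2 = real n ^ 3"
      using n0 by (simp add: powr_powr powr_numeral flip: powr_numeral)
    ultimately have "real n * (49 * (real n)\<^sup>2 * (c t0)\<^sup>2) < real n * (y\<^sup>2 / 4)"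
      by (simp add: power3_eq_cube power2_eq_square mult_ac)
    then show "(14 * real n * c t0)\<^sup>2 < y\<^sup>2" using n0 by (simp add: power_mult_distrib)
  qed (use ab y_def in simp)
  have conn: "(a, b) \<in> F\<^sup>*" using F_conn ab unfolding connected_on_def by blast
  have FI: "F \<subseteq> {1..n} \<times> {1..n}" using core_node[OF core_F] by (intro subsetI) (auto simp del: atLeastAtMost_iff)
  have "(x (t0 + 0) a - x (t0 + 0) b - real (card {1..n}) * (6 * c t0))\<^sup>2
    \<le> real (card {1..n}) * aw.total_energy * (5 / (4 * (1 / (6 * X))) + 20 * (real (3 * B) * r))"
  proof (rule aw.spread_window[OF FI conn ab(1)])
    show "0 < 1 / (6 * X)" using X32 by simp
    show "0 \<le> 6 * c t0" by simp
    show "real (card {1..n}) * (6 * c t0) \<le> x (t0 + 0) a - x (t0 + 0) b"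
    proof -
      have "real n * (6 * c t0) \<le> 14 * real n * c t0" by simp
      then have "real n * (6 * c t0) \<le> y" using y14 by linarith
      then show ?thesis unfolding y_def by simp
    qed
    fix i j assume ij: "(i, j) \<in> F"
    note core = core_F[OF ij]
    obtain s where s: "k * B < s" "s \<le> (k + 3) * B" and e: "(i, j) \<in> E s"
      and q0: "q s i j = 0" "q s j i = 0"
      using quiet_time[OF core k late tr[OF core] tr[OF core_sym[OF core]]] .
    have s1: "1 \<le> s" using s by simp
    \<comment> \<open>The weights of step \<open>s\<close> act on the values at
      \<open>s - 1\<close>, hence the shift by one.\<close>
    define \<tau> where "\<tau> = s - 1 - t0"
    have \<tau>: "\<tau> < 3 * B" "Suc (t0 + \<tau>) = s" "t0 + \<tau> = s - 1"
      using s t01 unfolding \<tau>_def t0_def by auto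
    have "1 / (6 * X) \<le> weight s i j \<or> \<bar>x (s - 1) i - x (s - 1) j\<bar> \<le> 6 * c t0"
    proof (cases "j \<in> act i s")
      case True
      have "D i j s * real s powr \<beta> \<le> X"
        unfolding X_def using D_bounds(2,4)[OF s1 e] s \<beta>_pos
        by (intro mult_mono powr_mono2) (auto simp del: of_nat_mult)
      moreover have "0 < D i j s * real s powr \<beta>" using D_bounds(4)[OF s1 e] s1 by simp
      ultimately have "1 / (6 * X) \<le> 1 / (6 * D i j s * real s powr \<beta>)"
        by (simp add: divide_simps mult.assoc)
      then show ?thesis using weight_bounds(2)[OF s1 True] by linarith
    next
      case False
      \<comment> \<open>Silent but not active: the estimates differ by at most four quanta and each
        is within one quantum of its value, which makes six.\<close>
      then have "\<bar>xin s i j - xout s i j\<bar> \<le> 4 * c s"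
        using e q0 unfolding active_def nbrs_def by (simp add: powr_minus_divide)
      then have "\<bar>x (s - 1) i - x (s - 1) j\<bar> \<le> 6 * c s"
        using msg_zeroD(1)[OF s1 e q0(1)] msg_zeroD(1)[OF s1 E_sym[OF e s1] q0(2)]
          edge_symmetric[OF s1 e] by linarith
      moreover have "c s \<le> c t0" using c_antimono[OF t0, of s] s unfolding t0_def by simp
      ultimately show ?thesis by linarith
    qed
    then show "\<exists>\<tau><3 * B. 1 / (6 * X) \<le> weight (Suc (t0 + \<tau>)) i j \<or>
        \<bar>x (t0 + \<tau>) i - x (t0 + \<tau>) j\<bar> \<le> 6 * c t0"
      using \<tau> by (intro exI[of _ \<tau>]) simp
  qed
  then have "(y - real n * (6 * c t0))\<^sup>2 \<le> real n * aw.total_energy * (7.5 * X + 20 * (real (3 * B) * r))"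
    unfolding y_def by simp
  \<comment> \<open>The factor 7.5 is 5/4 times 6. The travel term is 30 times
    \<open>real B / real t0 powr \<beta>\<close>, hence less than 1, and fits into the remaining
    \<open>X / 2\<close> because \<open>X\<close> is at least 32.\<close>
  also have "\<dots> \<le> real n * aw.total_energy * (8 * X)"
  proof (rule mult_left_mono)
    have "real B / real t0 powr \<beta> \<le> 1 / 32"
      using t0\<beta> t0 by (simp add: divide_le_eq)
    moreover have "20 * (real (3 * B) * r) = 30 * (real B / real t0 powr \<beta>)"
      unfolding r_def by simp
    ultimately show "7.5 * X + 20 * (real (3 * B) * r) \<le> 8 * X" using X32 by linarith
    show "0 \<le> real n * aw.total_energy" using aw.total_energy_nonneg by simp
  qed
  also have "aw.total_energy \<le> 2 * ((V2 n (x t0))\<^sup>2 - (V2 n (x (t0 + 3 * B)))\<^sup>2)"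
    using aw.sum_sq_dist_window[of avg] unfolding V2_sq by simp
  finally have en: "(y - real n * (6 * c t0))\<^sup>2
      \<le> real n * (2 * ((V2 n (x t0))\<^sup>2 - (V2 n (x (t0 + 3 * B)))\<^sup>2)) * (8 * X)"
    using n0 X32 by simp
  let ?d = "(V2 n (x t0))\<^sup>2 - (V2 n (x (t0 + 3 * B)))\<^sup>2"
  \<comment> \<open>Edges with nearly equal end points account for at most 3/7 of the range, so 4/7
    remains for the energy. Squaring leads to the factor 49/4, that is 12.25, which is then rounded
    to 12.5.\<close>
  have "real n * (6 * c t0) = 3 / 7 * (14 * real n * c t0)" by simp
  then have "4 / 7 * y \<le> y - real n * (6 * c t0)" using y14 by linarith
  then have "(4 / 7 * y)\<^sup>2 \<le> (y - real n * (6 * c t0))\<^sup>2"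
    using ab(3) unfolding y_def[symmetric] by (intro power_mono) auto
  also have "\<dots> \<le> real n * (2 * ?d) * (8 * X)" by (rule en)
  also have "\<dots> = 16 * (real n * ?d * X)" by (simp only: mult_ac)
  finally have "16 / 49 * y\<^sup>2 \<le> 16 * (real n * ?d * X)" by (simp only: power_mult_distrib power_divide) simp
  then have "y\<^sup>2 \<le> 49 * (real n * ?d * X)" by linarith
  then have "real n / 4 * y\<^sup>2 \<le> real n / 4 * (49 * (real n * ?d * X))" using n0 by (intro mult_left_mono) auto
  then have "(V2 n (x t0))\<^sup>2 \<le> real n / 4 * (49 * (real n * ?d * X))" using V2y unfolding y_def by linarith
  also have "\<dots> = 12.25 * ((real n)\<^sup>2 * X * ?d)" by (simp add: power2_eq_square)
  also have "\<dots> \<le> 12.5 * ((real n)\<^sup>2 * X * ?d)"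
  proof (rule mult_right_mono)
    have "V2 n (x (t0 + 3 * B)) \<le> V2 n (x t0)" by (rule V2_antimono) simp
    then have "0 \<le> ?d" using V2_nonneg by (simp add: power_mono)
    then show "0 \<le> (real n)\<^sup>2 * X * ?d" using X32 by simp
  qed simp
  finally show ?thesis unfolding t01 unfolding X_def t0_def by (simp only: mult_ac)
qed

end

text \<open>Over one window a power law loses less than the exponential factor does, so an envelope
  of order \<open>c\<close> survives the step. The key estimate is
  \<open>e * (a + d) powr b \<le> a\<close>: it makes the exponent at least \<open>d / a\<close>,
  and then \<open>exp\<close> of it is at least \<open>(a + d) / a\<close>.\<close>

lemma powr_exp_window:
  fixes a d e s b :: real
  assumes a: "0 < a" and d: "0 \<le> d" "d \<le> 3 / 32 * a" and e: "0 < e" "4 * e \<le> a powr (1 - b)"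
    and s: "0 \<le> s" "s \<le> 1" and b: "0 < b" "b < 1"
  shows "a powr - s * exp (- (d / (e * (a + d) powr b))) \<le> (a + d) powr - s"
proof -
  let ?u = "d / (e * (a + d) powr b)"
  have ratio: "(a + d) / a = 1 + d / a" "(a + d) / a \<le> 35 / 32"
    using a d by (auto simp: field_simps)
  have "(a + d) powr b = a powr b * ((a + d) / a) powr b" using a d by (simp add: powr_divide)
  also have "\<dots> \<le> a powr b * (35 / 32)"
    using powr_ratio_le(2)[of a "a + d" b] a d b ratio by (intro mult_left_mono) auto
  finally have "e * (a + d) powr b \<le> e * (35 / 32 * a powr b)" using e by simp
  also have "\<dots> = 35 / 128 * (4 * e * a powr b)" by simp
  also have "\<dots> \<le> 1 * (a powr (1 - b) * a powr b)" using e by (intro mult_mono) auto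
  also have "\<dots> = a" using a by (simp flip: powr_add)
  finally have "d / a \<le> ?u" using a d e by (intro divide_left_mono mult_pos_pos) auto
  then have "(a + d) / a \<le> exp ?u" using ratio(1) exp_ge_add_one_self[of ?u] by linarith
  then have "exp (- ?u) \<le> a / (a + d)"
    using a d by (simp add: exp_minus pos_divide_le_eq pos_le_divide_eq inverse_eq_divide mult.commute)
  then have "a powr - s * exp (- ?u) \<le> a powr - s * (a / (a + d))" by (intro mult_left_mono) auto
  also have "\<dots> \<le> (a + d) powr - s" using a d s by (intro powr_minus_ratio) auto
  finally show ?thesis .
qed

section \<open>Exponential decay down to an envelope of order \<open>c\<close>\<close>

context protocol
begin

text \<open>The constant 75 is six times the 12.5 of \<open>window_energy\<close>: a window has
  \<open>3 * B\<close> steps, and passing from squares to \<open>V2\<close> halves the rate.\<close>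

abbreviation \<kappa> :: real where "\<kappa> \<equiv> 75 * (real n)\<^sup>2 * \<D> * real B"

lemma \<kappa>_pos: "0 < \<kappa>"
  using n_pos B_pos Dsup_ge_1 by simp

text \<open>The energy estimate contracts the square of \<open>V2\<close> by
  \<open>1 - 1 / Y\<close>, which is at most \<open>exp (- (1 / Y))\<close>; the square root halves
  the exponent.\<close>

lemma window_decay:
  assumes k: "32 \<le> k" and late: "late (k * B)"
    and tr: "\<And>i j. core i j \<Longrightarrow> tracked k i j"
    and big: "7 * real n powr 1.5 * c (k * B) < V2 n (x (k * B))"
  shows "V2 n (x ((k + 3) * B)) \<le> V2 n (x (k * B)) * exp (- (3 * real B / (\<kappa> * real ((k + 3) * B) powr \<beta>)))"
proof -
  define Y where "Y = 12.5 * (real n)\<^sup>2 * (\<D> * real ((k + 3) * B) powr \<beta>)"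
  let ?u = "(V2 n (x (k * B)))\<^sup>2" and ?v = "(V2 n (x ((k + 3) * B)))\<^sup>2"
  have Y: "0 < Y" unfolding Y_def using n_pos B_pos Dsup_ge_1 by simp
  have e: "3 * real B / (\<kappa> * real ((k + 3) * B) powr \<beta>) = 1 / Y / 2"
    unfolding Y_def using n_pos B_pos Dsup_ge_1 by (simp add: field_simps)
  have "?u \<le> Y * (?u - ?v)" using window_energy[OF assms] unfolding Y_def .
  then have "?v \<le> ?u * (1 + - (1 / Y))" using Y by (simp add: field_simps)
  also have "\<dots> \<le> ?u * exp (- (1 / Y))" by (intro mult_left_mono exp_ge_add_one_self) simp
  also have "\<dots> = (V2 n (x (k * B)) * exp (- (1 / Y / 2)))\<^sup>2"
    by (simp add: power_mult_distrib flip: exp_double)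
  finally show ?thesis unfolding e by (rule power2_le_imp_le) (simp add: V2_nonneg)
qed

text \<open>The gap between the factor 7 in the window estimate and the factor 8 in the envelope absorbs
  the decrease of \<open>c\<close> over one window.\<close>

lemma decay:
  assumes K: "32 \<le> K" and late: "late (K * B)"
    and tr: "\<And>i j. core i j \<Longrightarrow> tracked K i j"
    and K\<kappa>: "4 * \<kappa> \<le> real (K * B) powr (1 - \<beta>)"
  shows "V2 n (x ((K + 3 * m) * B)) \<le> max
    (V2 n (x 0) * exp (- ((real ((K + 3 * m + 3) * B) powr (1 - \<beta>) - real ((K + 3) * B) powr (1 - \<beta>)) / \<kappa>)))
    (8 * real n powr 1.5 * c ((K + 3 * m) * B))"
proof (induction m)
  case 0
  then show ?case using V2_antimono[of 0 "K * B"] by simp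
next
  case (Suc m)
  define k where "k = K + 3 * m"
  define v where "v = real ((k + 3) * B) powr (1 - \<beta>)"
  define v' where "v' = real ((k + 3 + 3) * B) powr (1 - \<beta>)"
  define v0 where "v0 = real ((K + 3) * B) powr (1 - \<beta>)"
  define u where "u = 3 * real B / (\<kappa> * real ((k + 3) * B) powr \<beta>)"
  have k: "32 \<le> k" "late (k * B)" "K \<le> k" using K late_mono[OF late] unfolding k_def by auto
  have trk: "tracked k i j" if "core i j" for i j
    using tracked_mono[OF that K late tr[OF that] k(3)] .
  have IH: "V2 n (x (k * B)) \<le> max (V2 n (x 0) * exp (- ((v - v0) / \<kappa>))) (8 * real n powr 1.5 * c (k * B))"
    using Suc.IH unfolding k_def v_def v0_def .
  have sh: "K + 3 * Suc m = k + 3" unfolding k_def by simp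
  have kB: "0 < real (k * B)" "real (k * B) \<le> real ((k + 3) * B)"
    "real ((k + 3) * B) = real (k * B) + 3 * real B" "real ((k + 3 + 3) * B) = real ((k + 3) * B) + 3 * real B"
    using k B_pos by (auto simp: algebra_simps)
  have "V2 n (x ((k + 3) * B)) \<le> max (V2 n (x 0) * exp (- ((v' - v0) / \<kappa>))) (8 * real n powr 1.5 * c ((k + 3) * B))"
  proof (cases "7 * real n powr 1.5 * c (k * B) < V2 n (x (k * B))")
    case False
    have "V2 n (x ((k + 3) * B)) \<le> V2 n (x (k * B))" by (intro V2_antimono) simp
    also have "\<dots> \<le> real n powr 1.5 * (7 * c (k * B))" using False by simp
    also have "\<dots> \<le> real n powr 1.5 * (8 * c ((k + 3) * B))"
    proof (rule mult_left_mono)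
      show "7 * c (k * B) \<le> 8 * c ((k + 3) * B)"
        using c_block(2)[OF k(1)] powr_ge_zero[of "real (k * B)" "- \<alpha>"] by linarith
    qed simp
    finally show ?thesis by simp
  next
    case True
    have "V2 n (x ((k + 3) * B)) \<le> V2 n (x (k * B)) * exp (- u)"
      unfolding u_def by (rule window_decay[OF k(1,2) trk True])
    also have "\<dots> \<le> max (V2 n (x 0) * exp (- ((v - v0) / \<kappa>))) (8 * real n powr 1.5 * c (k * B)) * exp (- u)"
      using IH by (intro mult_right_mono) auto
    also have "\<dots> = max (V2 n (x 0) * (exp (- ((v - v0) / \<kappa>)) * exp (- u)))
        (8 * real n powr 1.5 * (c (k * B) * exp (- u)))"
      by (simp add: max_mult_distrib_right mult.assoc)
    also have "\<dots> \<le> max (V2 n (x 0) * exp (- ((v' - v0) / \<kappa>))) (8 * real n powr 1.5 * c ((k + 3) * B))"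
    proof (intro max.mono mult_left_mono)
      \<comment> \<open>The rate of a window is taken at its end, whereas
        \<open>powr_diff_le\<close> takes the slope at the left end. Hence the exponent measures
        time one window ahead, here from \<open>k + 3\<close> to \<open>k + 6\<close>
        blocks.\<close>
      have "v' - v \<le> (real ((k + 3 + 3) * B) - real ((k + 3) * B)) * real ((k + 3) * B) powr (1 - \<beta> - 1)"
        unfolding v_def v'_def using kB(1-3) \<beta>_pos \<beta>_less unfolding kB(4) by (intro powr_diff_le) auto
      also have "\<dots> = 3 * real B * real ((k + 3) * B) powr (1 - \<beta> - 1)" unfolding kB(4) by simp
      also have "\<dots> = u * \<kappa>"
      proof -
        have "a / (w * z) * w = a / z" if "0 < w" for a w z :: real using that by simp
        then show ?thesis unfolding u_def using \<kappa>_pos by (simp only: powr_minus_divide) (simp add: powr_minus_divide)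
      qed
      finally have "(v' - v) / \<kappa> \<le> u" using \<kappa>_pos by (simp add: pos_divide_le_eq)
      then have "(v' - v0) / \<kappa> \<le> (v - v0) / \<kappa> + u" by (simp add: diff_divide_distrib)
      then show "exp (- ((v - v0) / \<kappa>)) * exp (- u) \<le> exp (- ((v' - v0) / \<kappa>))"
        by (simp flip: exp_add)
      have "32 * real B \<le> real (k * B)" unfolding of_nat_mult using k(1) by (intro mult_right_mono) auto
      then have "3 * real B \<le> 3 / 32 * real (k * B)" by linarith
      moreover have "4 * \<kappa> \<le> real (k * B) powr (1 - \<beta>)"
      proof (rule order_trans[OF K\<kappa>], intro powr_mono2)
        show "real (K * B) \<le> real (k * B)" using k(3) by (intro of_nat_mono mult_right_mono) auto
      qed (use \<beta>_less in auto)
      ultimately show "c (k * B) * exp (- u) \<le> c ((k + 3) * B)"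
        unfolding u_def kB(3) using kB(1) \<kappa>_pos \<alpha>_pos \<alpha>_less_1 \<beta>_pos \<beta>_less
        by (intro powr_exp_window) simp_all
    qed (auto simp: V2_nonneg)
    finally show ?thesis .
  qed
  then show ?case unfolding sh v'_def v0_def .
qed

section \<open>The explicit starting time and the final bound\<close>

definition T1 :: real where
  "T1 = real_of_int \<lceil>32 * real B + 8 * real B * W\<rceil> powr (1 / (\<beta> - \<alpha>))"

text \<open>From \<open>T1\<close> on, \<open>late\<close> holds. The first two summands leave
  enough time after \<open>T1\<close> for the messages to remove the initial error of the estimates;
  the third secures \<open>4 * \<kappa> \<le> real (K * B) powr (1 - \<beta>)\<close>.\<close>

definition start :: real where
  "start = 2 powr (2 / (1 - \<alpha>)) * T1 + (32 * real B * M) powr (2 / (1 - \<alpha>))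
    + (300 * real n ^ 3 * \<D> * real B) powr (1 / (1 - \<beta>))"

text \<open>Two block boundaries are used: \<open>m * B\<close>, the first one not before
  \<open>T1\<close>, from which the messages are counted, and \<open>K * B\<close>, the first one
  not before \<open>start\<close>, at which tracking is established. Rounding up to a multiple of
  \<open>B\<close> costs at most \<open>B\<close>.\<close>

lemma tracking_start:
  obtains K where "32 \<le> K" "late (K * B)" "\<And>i j. core i j \<Longrightarrow> tracked K i j"
    "4 * \<kappa> \<le> real (K * B) powr (1 - \<beta>)" "real (K * B) \<le> start + real B"
proof -
  define Y where "Y = real_of_int \<lceil>32 * real B + 8 * real B * W\<rceil>"
  define R where "R = 300 * real n ^ 3 * \<D> * real B"
  define K where "K = nat \<lceil>start / real B\<rceil>"
  define m where "m = nat \<lceil>T1 / real B\<rceil>"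
  have B1: "1 \<le> real B" using B_pos by simp
  have Y: "32 * real B + 8 * real B * W \<le> Y" unfolding Y_def by linarith
  moreover have "0 \<le> 8 * real B * W" using W_nonneg by simp
  ultimately have Y32: "32 * real B \<le> Y" "1 \<le> Y" using B1 by linarith+
  have "1 \<le> 1 / (\<beta> - \<alpha>)" using \<alpha>_pos \<alpha>_less \<beta>_less by simp
  then have "Y powr 1 \<le> T1" unfolding T1_def Y_def[symmetric] using Y32 by (intro powr_mono) auto
  then have T1: "32 * real B \<le> T1" using Y32 by simp
  have T1Y: "T1 powr (\<beta> - \<alpha>) = Y"
    unfolding T1_def Y_def[symmetric] using Y32 \<alpha>_less by (simp add: powr_powr)
  have ceil: "T \<le> real (nat \<lceil>T / real B\<rceil> * B) \<and> real (nat \<lceil>T / real B\<rceil> * B) \<le> T + real B"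
    if "0 \<le> T" for T
  proof -
    have r: "T / real B \<le> real (nat \<lceil>T / real B\<rceil>)" "real (nat \<lceil>T / real B\<rceil>) \<le> T / real B + 1"
      using that by (auto simp: of_nat_nat ceiling_le_iff less_imp_le)
    then show ?thesis
      using mult_right_mono[OF r(1), of "real B"] mult_right_mono[OF r(2), of "real B"] B1
      by (simp add: distrib_right)
  qed
  have m: "T1 \<le> real (m * B)" "real (m * B) \<le> T1 + real B"
    using ceil[of T1] T1 unfolding m_def by auto
  have "(4::real) = 2 powr 2" by simp
  also have "\<dots> \<le> 2 powr (2 / (1 - \<alpha>))"
    using \<alpha>_pos \<alpha>_less_1 by (intro powr_mono) (auto simp: field_simps)
  finally have "4 * T1 \<le> 2 powr (2 / (1 - \<alpha>)) * T1" using T1 B1 by (intro mult_right_mono) auto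
  then have start_ge: "4 * T1 \<le> start" "2 powr (2 / (1 - \<alpha>)) * T1 \<le> start"
    "(32 * real B * M) powr (2 / (1 - \<alpha>)) \<le> start" "R powr (1 / (1 - \<beta>)) \<le> start"
    using T1 B1 powr_ge_zero[of R "1 / (1 - \<beta>)"] powr_ge_zero[of "32 * real B * M" "2 / (1 - \<alpha>)"]
    unfolding start_def R_def[symmetric] by linarith+
  have K: "start \<le> real (K * B)" "real (K * B) \<le> start + real B"
    using ceil[of start] start_ge T1 B1 unfolding K_def by auto
  have "real (m * B) \<le> real (K * B)" using m K start_ge T1 B1 by linarith
  then have mK: "m \<le> K" using B_pos by simp
  have "32 * real B \<le> real (m * B)" using T1 m by linarith
  then have m32: "32 \<le> m" using B_pos by simp
  have latem: "late (m * B)"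
  proof -
    have "T1 powr (\<beta> - \<alpha>) \<le> real (m * B) powr (\<beta> - \<alpha>)"
      using m T1 B1 \<alpha>_less by (intro powr_mono2) auto
    then show ?thesis using Y T1Y m32 B_pos unfolding late_def by simp
  qed
  have sum: "3 * real B * M \<le> real (K * B) powr (1 - \<alpha>) - real (m * B) powr (1 - \<alpha>)"
  proof -
    let ?q = "1 - \<alpha>"
    have q: "0 < ?q" using \<alpha>_less_1 by simp
    have sq: "(z powr (2 / ?q)) powr ?q = z\<^sup>2" if "0 \<le> z" for z
    proof -
      have "2 / u * u = 2" if "0 < u" for u :: real using that by simp
      then have "2 / ?q * ?q = 2" using q by blast
      then show ?thesis using that by (simp only: powr_powr) simp
    qed
    have T1q: "1 \<le> T1 powr ?q" using T1 B1 q by (intro ge_one_powr_ge_zero) auto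
    have "4 * T1 powr ?q = (2 powr (2 / ?q) * T1) powr ?q"
      using T1 B1 by (simp add: powr_mult sq)
    also have "\<dots> \<le> real (K * B) powr ?q"
      using q start_ge K T1 B1 by (intro powr_mono2) auto
    finally have K1: "4 * T1 powr ?q \<le> real (K * B) powr ?q" .
    have "(32 * real B * M)\<^sup>2 = ((32 * real B * M) powr (2 / ?q)) powr ?q"
      using M_nonneg by (simp add: sq)
    also have "\<dots> \<le> real (K * B) powr ?q"
      using q start_ge K by (intro powr_mono2) auto
    finally have K2: "(32 * real B * M)\<^sup>2 \<le> real (K * B) powr ?q" .
    have "real (m * B) powr ?q \<le> (2 * T1) powr ?q"
      using m T1 B1 q by (intro powr_mono2) auto
    also have "\<dots> = 2 powr ?q * T1 powr ?q" using T1 B1 by (simp add: powr_mult)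
    also have "\<dots> \<le> 2 powr 1 * T1 powr ?q"
      using \<alpha>_pos by (intro mult_right_mono powr_mono) auto
    finally have m2: "real (m * B) powr ?q \<le> 2 * T1 powr ?q" by simp
    \<comment> \<open>Half of \<open>real (K * B) powr ?q\<close> covers the power at
      \<open>m * B\<close>, so the other half must cover \<open>3 * real B * M\<close>. If
      \<open>32 * real B * M\<close> is at least 1, it is at most its square; otherwise
      \<open>3 * real B * M\<close> is below 1 and the bound by \<open>T1\<close> suffices.\<close>
    have BM: "3 * real B * M \<le> real (K * B) powr ?q / 2"
    proof (cases "1 \<le> 32 * real B * M")
      case True
      then have "32 * real B * M * 1 \<le> 32 * real B * M * (32 * real B * M)"
        by (intro mult_left_mono) auto
      then show ?thesis using K2 True unfolding power2_eq_square by linarith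
    next
      case False
      then show ?thesis using K1 T1q by linarith
    qed
    then show ?thesis using m2 K1 by linarith
  qed
  have R0: "0 < R" unfolding R_def using n_pos B_pos Dsup_ge_1 by simp
  have "4 * \<kappa> \<le> real (K * B) powr (1 - \<beta>)"
  proof -
    have "(real n)\<^sup>2 \<le> real n ^ 3" using n_pos by (intro power_increasing) auto
    then have "300 * (real n)\<^sup>2 * (\<D> * real B) \<le> 300 * real n ^ 3 * (\<D> * real B)"
      using Dsup_ge_1 by (intro mult_right_mono) auto
    then have "4 * \<kappa> \<le> R" unfolding R_def by (simp add: mult_ac)
    also have "R = (R powr (1 / (1 - \<beta>))) powr (1 - \<beta>)"
      using R0 \<beta>_less by (simp add: powr_powr)
    also have "\<dots> \<le> real (K * B) powr (1 - \<beta>)"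
      using start_ge K \<beta>_less by (intro powr_mono2) auto
    finally show ?thesis .
  qed
  moreover have "tracked K i j" if "core i j" for i j
    using tracked_eventually[OF that m32 latem mK sum] .
  moreover have "late (K * B)" using late_mono[OF latem] mK by simp
  ultimately show thesis using that[of K] m32 mK K(2) by simp
qed

text \<open>The factor \<open>2 powr (1 / (1 - \<beta>))\<close> makes
  \<open>real t powr (1 - \<beta>)\<close> at least twice the power at the start of the decay, so at
  least half of it is left for the exponent; this is why 150 is twice the 75 in
  \<open>\<kappa>\<close>. The term with \<open>1 / \<alpha>\<close> brings the envelope of order
  \<open>c\<close> below \<open>\<epsilon>\<close>.\<close>

lemma V2_bound:
  assumes \<epsilon>: "0 < \<epsilon>"
    and t: "2 powr (1 / (1 - \<beta>)) *
       (2 powr (2 / (1 - \<alpha>)) * real_of_int \<lceil>32 * real B + 8 * real B * W\<rceil> powr (1 / (\<beta> - \<alpha>))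
        + (32 * real B * M) powr (2 / (1 - \<alpha>)) + 11 * real B
        + (300 * real n ^ 3 * \<D> * real B) powr (1 / (1 - \<beta>)))
     + max (if V2 n (x 0) \<le> \<epsilon> then 0
            else (150 * real n ^ 3 * \<D> * real B * ln (V2 n (x 0) / \<epsilon>)) powr (1 / (1 - \<beta>)))
           ((8 * real n powr 1.5 / \<epsilon>) powr (1 / \<alpha>)) \<le> real t"
  shows "V2 n (x t) \<le> \<epsilon>"
proof (cases "V2 n (x 0) \<le> \<epsilon>")
  case True
  then show ?thesis using V2_antimono[of 0 t] by simp
next
  case False
  let ?p = "1 - \<beta>"
  have p: "0 < ?p" using \<beta>_less by simp
  define L where "L = ln (V2 n (x 0) / \<epsilon>)"
  define A where "A = 150 * real n ^ 3 * \<D> * real B * L"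
  define H where "H = 8 * real n powr 1.5 / \<epsilon>"
  \<comment> \<open>The \<open>11 * real B\<close> covers the rounding in
    \<open>tracking_start\<close>, the three blocks by which \<open>decay\<close> looks ahead at its
    start, and the at most three blocks between the last window end and \<open>t\<close>.\<close>
  define T0 where "T0 = start + 11 * real B"
  have V0: "0 < V2 n (x 0)" and L: "0 < L"
    using False \<epsilon> unfolding L_def by (auto intro!: ln_gt_zero)
  have A: "0 \<le> A" unfolding A_def using L Dsup_ge_1 by simp
  have H: "0 < H" unfolding H_def using \<epsilon> n_pos by simp
  obtain K where K: "32 \<le> K" "late (K * B)" "\<And>i j. core i j \<Longrightarrow> tracked K i j"
    "4 * \<kappa> \<le> real (K * B) powr (1 - \<beta>)" "real (K * B) \<le> start + real B"
    by (rule tracking_start) blast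
  have t': "2 powr (1 / ?p) * T0 + max (A powr (1 / ?p)) (H powr (1 / \<alpha>)) \<le> real t"
    using t False unfolding T0_def start_def T1_def A_def L_def H_def by (simp add: algebra_simps)
  have "0 \<le> real (K * B)" by simp
  then have T0: "real (K * B) + 10 * real B \<le> T0" "0 < T0"
    using K(5) B_pos unfolding T0_def by linarith+
  have "1 * T0 \<le> 2 powr (1 / ?p) * T0"
    using T0 p by (intro mult_right_mono ge_one_powr_ge_zero) auto
  then have t1: "T0 + H powr (1 / \<alpha>) \<le> real t" "2 powr (1 / ?p) * T0 \<le> real t" "A powr (1 / ?p) \<le> real t"
    using t' T0 powr_ge_zero[of A "1 / ?p"] powr_ge_zero[of H "1 / \<alpha>"]
      max.cobounded1[of "A powr (1 / ?p)" "H powr (1 / \<alpha>)"] max.cobounded2[of "H powr (1 / \<alpha>)" "A powr (1 / ?p)"]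
    by linarith+
  \<comment> \<open>The number of complete windows of \<open>3 * B\<close> steps between
    \<open>K * B\<close> and \<open>t\<close>.\<close>
  define m where "m = (t - K * B) div (3 * B)"
  define s where "s = (K + 3 * m) * B"
  have "real (K * B) \<le> real t" using t1 T0 powr_ge_zero[of H "1 / \<alpha>"] by linarith
  then have KBt: "K * B \<le> t" by (simp only: of_nat_le_iff)
  have sm: "s = K * B + 3 * B * m" unfolding s_def by (simp add: algebra_simps)
  have "t - K * B = 3 * B * m + (t - K * B) mod (3 * B)" unfolding m_def by simp
  moreover have "(t - K * B) mod (3 * B) < 3 * B" using B_pos by simp
  ultimately have s: "s \<le> t" "t \<le> s + 3 * B" using KBt unfolding sm by linarith+
  have s3: "(K + 3 * m + 3) * B = s + 3 * B" unfolding s_def by (simp add: algebra_simps)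
  have "real t \<le> real s + 3 * real B" using s(2) by (simp flip: of_nat_le_iff)
  then have sH: "H powr (1 / \<alpha>) \<le> real s" using t1 T0 B_pos \<open>0 \<le> real (K * B)\<close> by linarith
  have "V2 n (x t) \<le> V2 n (x s)" by (rule V2_antimono[OF s(1)])
  also have "\<dots> \<le> max
    (V2 n (x 0) * exp (- ((real (s + 3 * B) powr ?p - real ((K + 3) * B) powr ?p) / \<kappa>)))
    (8 * real n powr 1.5 * c s)"
    using decay[OF K(1-4), of m] unfolding s3 s_def[symmetric] .
  also have "\<dots> \<le> \<epsilon>"
  proof (rule max.boundedI)
    have "real ((K + 3) * B) \<le> T0" using T0 B_pos by (simp add: algebra_simps)
    then have v0: "real ((K + 3) * B) powr ?p \<le> T0 powr ?p" using p by (intro powr_mono2) auto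
    have "2 * T0 powr ?p = (2 powr (1 / ?p) * T0) powr ?p"
      using p T0 by (simp add: powr_mult powr_powr)
    also have "\<dots> \<le> real t powr ?p" using p t1 T0 by (intro powr_mono2) auto
    finally have v1: "2 * T0 powr ?p \<le> real t powr ?p" .
    have "A = (A powr (1 / ?p)) powr ?p" using p A by (simp add: powr_powr)
    also have "\<dots> \<le> real t powr ?p" using p t1 by (intro powr_mono2) auto
    finally have v2: "A \<le> real t powr ?p" .
    have v3: "real t powr ?p \<le> real (s + 3 * B) powr ?p"
      using p s(2) by (intro powr_mono2) (auto simp only: of_nat_le_iff of_nat_0_le_iff)
    have "(real n)\<^sup>2 \<le> real n ^ 3" using n_pos by (intro power_increasing) auto
    then have "75 * (real n)\<^sup>2 * (\<D> * real B * L) \<le> 75 * real n ^ 3 * (\<D> * real B * L)"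
      using Dsup_ge_1 L by (intro mult_right_mono) auto
    then have "\<kappa> * L \<le> A / 2" unfolding A_def by (simp add: mult_ac)
    then have "\<kappa> * L \<le> real (s + 3 * B) powr ?p - real ((K + 3) * B) powr ?p"
      using v0 v1 v2 v3 by linarith
    then have "L \<le> (real (s + 3 * B) powr ?p - real ((K + 3) * B) powr ?p) / \<kappa>"
      using \<kappa>_pos by (simp add: pos_le_divide_eq mult.commute)
    then have "V2 n (x 0) * exp (- ((real (s + 3 * B) powr ?p - real ((K + 3) * B) powr ?p) / \<kappa>))
        \<le> V2 n (x 0) * exp (- L)"
      using V0 by (intro mult_left_mono) auto
    also have "\<dots> = \<epsilon>" unfolding L_def using V0 \<epsilon> by (simp add: exp_minus)
    finally show "V2 n (x 0) * exp (- ((real (s + 3 * B) powr ?p - real ((K + 3) * B) powr ?p) / \<kappa>)) \<le> \<epsilon>" .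
    have "H = (H powr (1 / \<alpha>)) powr \<alpha>" using H \<alpha>_pos by (simp add: powr_powr)
    also have "\<dots> \<le> real s powr \<alpha>" using sH \<alpha>_pos by (intro powr_mono2) auto
    finally have Hs: "H \<le> real s powr \<alpha>" .
    then have "0 < real s powr \<alpha>" using H by linarith
    then show "8 * real n powr 1.5 * c s \<le> \<epsilon>"
      using Hs \<epsilon> unfolding H_def by (simp add: powr_minus field_simps)
  qed
  finally show ?thesis .
qed

lemma converges:
  assumes "i \<in> {1..n}"
  shows "(\<lambda>t. x t i) \<longlonglongrightarrow> avg"
proof (rule LIMSEQ_I)
  fix r :: real assume "0 < r"
  \<comment> \<open>\<open>V2_bound\<close> gives a weak inequality; halving \<open>r\<close> yields
    the strict one required of a limit.\<close>
  then have r: "0 < r / 2" by simp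
  obtain N :: nat where N: "2 powr (1 / (1 - \<beta>)) *
       (2 powr (2 / (1 - \<alpha>)) * real_of_int \<lceil>32 * real B + 8 * real B * W\<rceil> powr (1 / (\<beta> - \<alpha>))
        + (32 * real B * M) powr (2 / (1 - \<alpha>)) + 11 * real B
        + (300 * real n ^ 3 * \<D> * real B) powr (1 / (1 - \<beta>)))
     + max (if V2 n (x 0) \<le> r / 2 then 0
            else (150 * real n ^ 3 * \<D> * real B * ln (V2 n (x 0) / (r / 2))) powr (1 / (1 - \<beta>)))
           ((8 * real n powr 1.5 / (r / 2)) powr (1 / \<alpha>)) \<le> real N"
    using real_arch_simple by blast
  have "norm (x t i - avg) < r" if "N \<le> t" for t
  proof -
    have "V2 n (x t) \<le> V2 n (x N)" by (rule V2_antimono[OF that])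
    also have "\<dots> \<le> r / 2" by (rule V2_bound[OF r N])
    finally show ?thesis using dist_avg_le_V2[OF assms, of t] \<open>0 < r\<close> unfolding real_norm_def by linarith
  qed
  then show "\<exists>N. \<forall>t\<ge>N. norm (x t i - avg) < r" by blast
qed

end

theorem theorem2p3:
  fixes n B :: nat and \<alpha> \<beta> :: real
    and E :: "nat \<Rightarrow> (nat \<times> nat) set"
    and D :: "nat \<Rightarrow> nat \<Rightarrow> nat \<Rightarrow> real"
    and x :: "nat \<Rightarrow> nat \<Rightarrow> real"
    and xin xout :: "nat \<Rightarrow> nat \<Rightarrow> nat \<Rightarrow> real"
  assumes "n \<ge> 1" and "B \<ge> 1"
    and "0 < \<alpha>" and "\<alpha> < \<beta>" and "\<beta> < 1"
    and "graph_sequence n E"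
    and "core_connected n B E"
    and "admissible_weights E D"
    and "protocol_run n \<alpha> \<beta> E D x xin xout"
  shows "(\<forall>i\<in>{1..n}. (\<lambda>t. x t i) \<longlonglongrightarrow> (1 / real n) * (\<Sum>j=1..n. x 0 j)) \<and>
    (\<forall>\<epsilon>>0. \<forall>t::nat.
       real t \<ge>
         2 powr (1 / (1 - \<beta>)) *
           (2 powr (2 / (1 - \<alpha>)) *
              real_of_int \<lceil>32 * real B + 8 * real B * spread n (x 0)\<rceil> powr (1 / (\<beta> - \<alpha>))
            + (32 * real B * sup_norm n (x 0)) powr (2 / (1 - \<alpha>))
            + 11 * real B
            + (300 * real n ^ 3 * Dsup E D * real B) powr (1 / (1 - \<beta>)))
         + max (if V2 n (x 0) \<le> \<epsilon> then 0
                else (150 * real n ^ 3 * Dsup E D * real B * ln (V2 n (x 0) / \<epsilon>)) powr (1 / (1 - \<beta>)))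
               ((8 * real n powr 1.5 / \<epsilon>) powr (1 / \<alpha>))
       \<longrightarrow> V2 n (x t) \<le> \<epsilon>)"
proof -
  obtain F where "connected_on n F" "\<And>k. F \<subseteq> (\<Union>t\<in>{k * B + 1..(k + 1) * B}. E t)"
    using \<open>core_connected n B E\<close> unfolding core_connected_def by blast
  then interpret protocol n B \<alpha> \<beta> E D x xin xout F
    using assms by unfold_locales
  show ?thesis using converges V2_bound by blast
qed

end
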